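(* Let \[ G(t,u) = \sum_{n \ge 1} t^n \sum_{P, Q \in \mathcal{S}_{2n},\ P \leq_{\mathcal{S}} Q} u^{|P|_D}, \] where $|P|_D$ is the number of diagonal steps in $P$, be the generating function of intervals in the posets $(\mathcal{S}_{2n},\leq_{\mathcal{S}})$. Then $G(t,u)$ is algebraic. More precisely, let $X'$ be the formal power series in $t$ with coefficients polynomial in $u$ that satisfies \[ u^2 t^2 X'^5 - t (1 + u^2 t) X'^4 - 2 u t X'^3 + 2 u t X'^2 + X' - 1 = 0. \] Then \[ G(t,u) = \frac{u^2 t^2 X'^4 - (u^2 t^2 + u t^2 + u t + 2t) X'^3 + (1 + u t + t) X' - 1}{t X' (u t X'^2 - 1)}. \]
   Context: A Schröder path is a non-empty lattice path in $\mathbb{Z}^2$ starting at $(0,0)$, ending on the diagonal $y=x$, staying weakly above the diagonal, with steps $N=(0,1)$, $E=(1,0)$, $D=(1,1)$, where the length counts each $N$ and each $E$ step as $1$ and each $D$ step as $2$. $\mathcal{S}_{2n}$ is the set of Schröder paths of length $2n$ (equivalently, those ending at $(n,n)$). Order: a valley of a path $P$ is a lattice point $v$ on $P$ preceded by an $E$ step and followed by an $N$ or $D$ step. Given a valley $v$ of $P$, let $w$ be the next lattice point on $P$ (end point of a step) after $v$ with the same horizontal distance to the diagonal as $v$ (the horizontal distance of $(a,b)$ is $b-a$). Exchanging the sub-path of $P$ between $v$ and $w$ with the $E$ step just before $v$ gives a Schröder path $Q$ of the same length; one says $Q$ covers $P$. The order $\leq_{\mathcal{S}}$ on $\mathcal{S}_{2n}$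 is the reflexive transitive closure of this covering relation. Intervals are identified with pairs $(P,Q)$ with $P\leq_{\mathcal{S}}Q$. "Algebraic" means algebraic over $\mathbb{Q}(t,u)$. There is exactly one formal power series $X'$ in $t$ with coefficients in $\mathbb{Q}[u]$ satisfying the displayed equation; it has constant term $1$. *)

theory Defs
  imports "HOL-Computational_Algebra.Computational_Algebra" "HOL-Library.Product_Plus"
begin

section \<open>Schroeder paths\<close>

datatype step = North | East | Diag

primrec step_vec :: "step \<Rightarrow> int \<times> int" where
  "step_vec North = (0, 1)"
| "step_vec East = (1, 0)"
| "step_vec Diag = (1, 1)"

primrec step_length :: "step \<Rightarrow> nat" where
  "step_length North = 1"
| "step_length East = 1"
| "step_length Diag = 2"

text \<open>A lattice path starting at the origin is the list of its steps; \<open>lattice_pt P k\<close>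
  is the lattice point reached after the first \<open>k\<close> steps.  The lattice points on \<open>P\<close> are the
  \<open>lattice_pt P k\<close> with \<open>k \<le> length P\<close>, and distinct such \<open>k\<close> give distinct points.\<close>

definition lattice_pt :: "step list \<Rightarrow> nat \<Rightarrow> int \<times> int" where
  "lattice_pt P k = (\<Sum>s\<leftarrow>take k P. step_vec s)"

definition hdist :: "int \<times> int \<Rightarrow> int" where
  "hdist v = snd v - fst v"

definition path_length :: "step list \<Rightarrow> nat" where
  "path_length P = (\<Sum>s\<leftarrow>P. step_length s)"

text \<open>No single step crosses the diagonal between two lattice points, so staying weakly above
  the diagonal is a condition on the lattice points of the path only.\<close>

definition schroeder_path :: "step list \<Rightarrow> bool" where
  "schroeder_path P \<longleftrightarrow>
     P \<noteq> [] \<and>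
     fst (lattice_pt P (length P)) = snd (lattice_pt P (length P)) \<and>
     (\<forall>k\<le>length P. fst (lattice_pt P k) \<le> snd (lattice_pt P k))"

text \<open>The argument is the semilength: \<open>schroeder_paths n\<close> consists of the paths of length \<open>2 * n\<close>.\<close>

definition schroeder_paths :: "nat \<Rightarrow> step list set" where
  "schroeder_paths n = {P. schroeder_path P \<and> path_length P = 2 * n}"

abbreviation diag_steps :: "step list \<Rightarrow> nat" where
  "diag_steps P \<equiv> count_list P Diag"

section \<open>The order on Schroeder paths\<close>

definition valley_at :: "step list \<Rightarrow> nat \<Rightarrow> bool" where
  "valley_at P i \<longleftrightarrow>
     0 < i \<and> i < length P \<and> P ! (i - 1) = East \<and> (P ! i = North \<or> P ! i = Diag)"

definition next_same_hdist :: "step list \<Rightarrow> nat \<Rightarrow> nat \<Rightarrow> bool" where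
  "next_same_hdist P i j \<longleftrightarrow>
     i < j \<and> j \<le> length P \<and> hdist (lattice_pt P j) = hdist (lattice_pt P i) \<and>
     (\<forall>k. i < k \<and> k < j \<longrightarrow> hdist (lattice_pt P k) \<noteq> hdist (lattice_pt P i))"

text \<open>\<open>schroeder_cover P Q\<close> means that \<open>Q\<close> covers \<open>P\<close>: the steps \<open>i, \<dots>, j - 1\<close> of \<open>P\<close> between
  the valley and the next point at the same horizontal distance are exchanged with the east
  step \<open>i - 1\<close> just before them.\<close>

definition schroeder_cover :: "step list \<Rightarrow> step list \<Rightarrow> bool" where
  "schroeder_cover P Q \<longleftrightarrow>
     schroeder_path P \<and>
     (\<exists>i j. valley_at P i \<and> next_same_hdist P i j \<and>
            Q = take (i - 1) P @ drop i (take j P) @ [East] @ drop j P)"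

definition schroeder_le :: "step list \<Rightarrow> step list \<Rightarrow> bool"  (infix \<open>\<le>\<^sub>S\<close> 50) where
  "P \<le>\<^sub>S Q \<longleftrightarrow> schroeder_cover\<^sup>*\<^sup>* P Q"

definition schroeder_intervals :: "nat \<Rightarrow> (step list \<times> step list) set" where
  "schroeder_intervals n =
     {(P, Q). P \<in> schroeder_paths n \<and> Q \<in> schroeder_paths n \<and> P \<le>\<^sub>S Q}"

lemma length_le_path_length: "length P \<le> path_length P"
proof (induction P)
  case (Cons s P)
  then show ?case by (cases s) (simp_all add: path_length_def)
qed (simp add: path_length_def)

text \<open>In particular the sums in the generating function below range over finite sets.\<close>

lemma finite_schroeder_paths: "finite (schroeder_paths n)"
proof (rule finite_subset)
  have "x = North \<or> x = East \<or> x = Diag" for x :: step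
    by (cases x) auto
  then have "(UNIV :: step set) = {North, East, Diag}" by auto
  then have "finite (UNIV :: step set)" by (metis finite.emptyI finite.insertI)
  then show "finite {P :: step list. set P \<subseteq> UNIV \<and> length P \<le> 2 * n}"
    by (rule finite_lists_length_le)
  show "schroeder_paths n \<subseteq> {P. set P \<subseteq> UNIV \<and> length P \<le> 2 * n}"
    using length_le_path_length by (auto simp: schroeder_paths_def) metis
qed

lemma finite_schroeder_intervals: "finite (schroeder_intervals n)"
  by (rule finite_subset[of _ "schroeder_paths n \<times> schroeder_paths n"])
     (auto simp: schroeder_intervals_def finite_schroeder_paths)

section \<open>Power series in \<open>t\<close> over the polynomials in \<open>u\<close>\<close>

abbreviation var_t :: "rat poly fps" where
  "var_t \<equiv> fps_X"

abbreviation var_u :: "rat poly fps" where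
  "var_u \<equiv> fps_const [:0, 1:]"

definition G :: "rat poly fps" where
  "G = Abs_fps (\<lambda>n. if n \<ge> 1
                    then \<Sum>(P, Q)\<in>schroeder_intervals n. [:0, 1:] ^ diag_steps P
                    else 0)"

text \<open>The series ring \<open>rat poly fps\<close> is a domain but its coefficients do not form a field, so
  quotients of series, and the field of rational functions in \<open>t\<close> and \<open>u\<close>, are taken inside
  its fraction field \<open>rat poly fps fract\<close>.  In \<open>rat poly poly\<close> the outer variable is \<open>t\<close> and
  the inner one is \<open>u\<close>.\<close>

definition rational_functions :: "rat poly fps fract set" where
  "rational_functions =
     {to_fract (fps_of_poly a) / to_fract (fps_of_poly b) | a b :: rat poly poly. b \<noteq> 0}"

definition algebraic_over :: "'a :: field set \<Rightarrow> 'a \<Rightarrow> bool" where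
  "algebraic_over K x \<longleftrightarrow> (\<exists>p. p \<noteq> 0 \<and> (\<forall>i. coeff p i \<in> K) \<and> poly p x = 0)"

end

theory Submission
  imports Defs "HOL-Algebra.Algebraic_Closure_Type"
begin

text \<open>Cut at its returns to the diagonal, a path is a list of primitive factors: diagonal steps and
  arches \<open>N A E\<close>.  An interval whose lower path starts with a diagonal step is an interval
  with one common diagonal step in front.  Otherwise, if the upper path starts with the arch
  \<open>N C E\<close>, the lower path is \<open>N A E B B'\<close> with \<open>A B\<close> below \<open>C\<close> and \<open>B'\<close> below the rest of
  the upper path.  With \<open>x\<close> marking the primitive factors of the lower path this gives
  \<open>(x - 1) (F(x) - 1) = t x F(x) (u (x - 1) + x F(x) - F(1))\<close>, where \<open>F(1) = 1 + G\<close>.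
  In the series \<open>x = X\<close> at which the derivative with respect to the unknown \<open>F\<close> vanishes, one gets
  \<open>X - 1 = t X^2 F(X)^2\<close> and \<open>F(X) (1 - u t X^2) = X\<close>; eliminating \<open>F(X)\<close>
  gives the quintic for \<open>X\<close> and the formula for \<open>G\<close>.  Elements algebraic over a subfield form a
  subfield, so \<open>G\<close> is algebraic.\<close>

no_notation var (\<open>X\<index>\<close>)
hide_const (open) up_ring.monom up_ring.coeff module.smult

section \<open>Paths as lists of primitive factors\<close>

text \<open>Matching each \<open>North\<close> with the \<open>East\<close> that closes it turns a
  path into a plane forest, on which induction is structural.\<close>

datatype primitive = Flat | Arch "primitive list"

fun word :: "primitive list \<Rightarrow> step list" where
  "word [] = []"
| "word (Flat # B) = Diag # word B"
| "word (Arch A # B) = North # word A @ East # word B"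

lemma word_append: "word (A @ B) = word A @ word B"
  by (induction A rule: word.induct) simp_all

lemma word_Cons: "word (p # B) = word [p] @ word B"
  using word_append[of "[p]" B] by simp

lemma word_eq_Nil_iff [simp]: "word A = [] \<longleftrightarrow> A = []"
  by (cases A rule: word.cases) simp_all

text \<open>The \<open>East\<close> after \<open>word A\<close> is the first step below the starting
  height, so it marks where \<open>word A\<close> ends. Carrying it along suits the induction: the
  inside of an arch is itself followed by \<open>East\<close>.\<close>

lemma word_East_inj: "word A @ East # x = word B @ East # y \<Longrightarrow> A = B \<and> x = y"
proof (induction A arbitrary: B x y rule: word.induct)
  case 1
  then show ?case by (cases B rule: word.cases) auto
next
  case (2 A)
  then show ?case by (cases B rule: word.cases) auto
next
  case (3 A1 A2)
  from "3.prems" obtain B1 B2 where B: "B = Arch B1 # B2"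
    by (cases B rule: word.cases) auto
  with "3.prems" have "word A1 @ East # (word A2 @ East # x) = word B1 @ East # (word B2 @ East # y)"
    by simp
  with "3.IH"(1) have "A1 = B1" "word A2 @ East # x = word B2 @ East # y" by blast+
  with "3.IH"(2) B show ?case by blast
qed

lemma word_inj: "word A = word B \<longleftrightarrow> A = B"
  using word_East_inj[of A "[]" B "[]"] by auto

section \<open>Heights and the words that stay weakly above the diagonal\<close>

definition height :: "step list \<Rightarrow> int" where
  "height w = hdist (\<Sum>s\<leftarrow>w. step_vec s)"

lemma height_simps [simp]:
  "height [] = 0"
  "height (North # w) = 1 + height w"
  "height (East # w) = height w - 1"
  "height (Diag # w) = height w"
  "height (v @ w) = height v + height w"
  by (simp_all add: height_def hdist_def)

text \<open>Unlike \<open>schroeder_path\<close>, this admits the empty word, so whatever remains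
  after removing a balanced prefix is again balanced.\<close>

definition balanced :: "step list \<Rightarrow> bool" where
  "balanced w \<longleftrightarrow> height w = 0 \<and> (\<forall>p q. w = p @ q \<longrightarrow> 0 \<le> height p)"

lemma hdist_lattice_pt: "hdist (lattice_pt P k) = height (take k P)"
  by (simp add: lattice_pt_def height_def)

lemma schroeder_path_iff_balanced: "schroeder_path P \<longleftrightarrow> P \<noteq> [] \<and> balanced P"
proof -
  have "fst (lattice_pt P k) \<le> snd (lattice_pt P k) \<longleftrightarrow> 0 \<le> height (take k P)" for k
    using hdist_lattice_pt[of P k] unfolding hdist_def by linarith
  moreover have "fst (lattice_pt P (length P)) = snd (lattice_pt P (length P)) \<longleftrightarrow> height P = 0"
    using hdist_lattice_pt[of P "length P"] by (auto simp: hdist_def)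
  moreover have "(\<forall>k\<le>length P. 0 \<le> height (take k P)) \<longleftrightarrow> (\<forall>p q. P = p @ q \<longrightarrow> 0 \<le> height p)"
  proof safe
    fix p q assume "\<forall>k\<le>length (p @ q). 0 \<le> height (take k (p @ q))" "P = p @ q"
    then show "0 \<le> height p" by (auto dest: spec[of _ "length p"])
  next
    fix k assume "\<forall>p q. P = p @ q \<longrightarrow> 0 \<le> height p"
    then show "0 \<le> height (take k P)" by (metis append_take_drop_id)
  qed
  ultimately show ?thesis by (simp add: schroeder_path_def balanced_def)
qed

lemma balanced_append: "balanced v \<Longrightarrow> balanced w \<Longrightarrow> balanced (v @ w)"
  unfolding balanced_def by (auto simp: append_eq_append_conv2)

lemma balanced_cancel: "balanced (v @ w) \<Longrightarrow> balanced v \<Longrightarrow> balanced w"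
  unfolding balanced_def
  by (metis add.left_neutral append.assoc height_simps(5))

lemma balanced_arch:
  assumes "balanced w"
  shows "balanced (North # w @ [East])"
proof -
  have "0 \<le> height p" if "North # w @ [East] = p @ q" for p q
  proof (cases p)
    case (Cons s p')
    with that have "w @ [East] = p' @ q" and s: "s = North" by auto
    then consider "q = []" "p' = w @ [East]" | r where "w = p' @ r"
      by (cases q rule: rev_cases) auto
    then show ?thesis
      using assms Cons s by cases (auto simp: balanced_def)
  qed simp
  then show ?thesis using assms by (simp add: balanced_def)
qed

lemma balanced_word: "balanced (word A)"
proof (induction A rule: word.induct)
  case 1
  show ?case by (simp add: balanced_def)
next
  case (2 B)
  have "balanced [Diag]" by (auto simp: balanced_def Cons_eq_append_conv)
  from balanced_append[OF this 2] show ?case by simp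
next
  case (3 A B)
  from balanced_append[OF balanced_arch[OF 3(1)] 3(2)] show ?case by simp
qed

lemma height_word [simp]: "height (word A) = 0"
  using balanced_word[of A] by (simp add: balanced_def)

text \<open>Cut the word at the first step that takes it below height 0. The induction is on length
  because after an arch it is applied a second time, to a shorter suffix.\<close>

lemma first_descent: "height w < 0 \<Longrightarrow> \<exists>A v. w = word A @ East # v"
proof (induction w rule: length_induct)
  case (1 w)
  show ?case
  proof (cases w)
    case Nil
    with 1 show ?thesis by simp
  next
    case (Cons s w')
    show ?thesis
    proof (cases s)
      case East
      then show ?thesis using Cons by (metis append_Nil word.simps(1))
    next
      case Diag
      then obtain A v where "w' = word A @ East # v" using 1 Cons by auto
      then show ?thesis using Cons Diag by (metis append_Cons word.simps(2))
    next
      case North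
      \<comment> \<open>The first descent of \<open>w'\<close> closes the arch opened here;
        \<open>v\<close> has the same negative height as \<open>w\<close>, and its first descent is
        that of \<open>w\<close>.\<close>
      then obtain A v where w': "w' = word A @ East # v" using 1 Cons by fastforce
      then have "height v < 0" using 1 Cons North by simp
      then obtain B v' where v: "v = word B @ East # v'" using 1 Cons w' by fastforce
      have "w = word (Arch A # B) @ East # v'" using Cons North w' v by simp
      then show ?thesis by blast
    qed
  qed
qed

lemma balanced_iff_word: "balanced w \<longleftrightarrow> (\<exists>A. w = word A)"
proof
  show "balanced w \<Longrightarrow> \<exists>A. w = word A"
  proof (induction w rule: length_induct)
    case (1 w)
    show ?case
    proof (cases w)
      case Nil
      then show ?thesis by (metis word.simps(1))
    next
      case (Cons s w')
      show ?thesis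
      proof (cases s)
        case East
        have "w = [East] @ w'" using Cons East by simp
        then have "0 \<le> height [East]" using \<open>balanced w\<close> unfolding balanced_def by blast
        then show ?thesis by simp
      next
        case Diag
        then have w: "w = word [Flat] @ w'" using Cons by simp
        then have "balanced w'" using 1 balanced_cancel balanced_word by blast
        then obtain A where "w' = word A" using 1 Cons by auto
        then show ?thesis using w by (metis word_append)
      next
        case North
        then have "height w' < 0" using 1 Cons by (simp add: balanced_def)
        then obtain A v where "w' = word A @ East # v" using first_descent by blast
        then have w: "w = word [Arch A] @ v" using Cons North by simp
        then have "balanced v" using 1 balanced_cancel balanced_word by blast
        then obtain B where "v = word B" using 1(1)[rule_format, of v] w by auto
        then show ?thesis using w by (metis word_append)
      qed
    qed
  qed
qed (auto simp: balanced_word)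

lemma schroeder_path_iff_word: "schroeder_path P \<longleftrightarrow> (\<exists>A. A \<noteq> [] \<and> P = word A)"
  by (auto simp: schroeder_path_iff_balanced balanced_iff_word)

text \<open>What is left after a balanced prefix is balanced, hence a word, and \<open>word\<close>
  is injective.\<close>

lemma word_prefix: "word B = word A @ w \<Longrightarrow> \<exists>C. B = A @ C \<and> w = word C"
  by (metis balanced_cancel balanced_iff_word balanced_word word_append word_inj)

section \<open>Covers as rotations of one primitive factor\<close>

text \<open>The surrounding steps \<open>v\<close> and \<open>w\<close> are arbitrary, which makes
  the relation stable under contexts such as the inside of an arch.\<close>

inductive rotation :: "step list \<Rightarrow> step list \<Rightarrow> bool" where
  "rotation (v @ East # word [p] @ w) (v @ word [p] @ East # w)"

lemma rotation_context: "rotation P Q \<Longrightarrow> rotation (v @ P @ w) (v @ Q @ w)"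
proof (induction rule: rotation.induct)
  case (1 v' p w')
  show ?case using rotation.intros[of "v @ v'" p "w' @ w"] by simp
qed

lemma rotations_context: "rotation\<^sup>*\<^sup>* P Q \<Longrightarrow> rotation\<^sup>*\<^sup>* (v @ P @ w) (v @ Q @ w)"
  by (induction rule: rtranclp_induct)
     (auto intro: rtranclp.rtrancl_into_rtrancl rotation_context)

text \<open>The piece between the two points has height 0, no proper non-empty prefix of height 0,
  and starts with \<open>Diag\<close> or \<open>North\<close>. A \<open>Diag\<close> is already such
  a piece; after a \<open>North\<close>, the first descent closes an arch, which returns to height 0
  and so is everything.\<close>

lemma next_same_hdist_word:
  assumes "valley_at P i" "next_same_hdist P i j"
  shows "\<exists>p. drop i (take j P) = word [p]"
proof -
  define s where "s = drop i (take j P)"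
  have ij: "i < j" "j \<le> length P" using assms(2) by (auto simp: next_same_hdist_def)
  have split: "take j P = take i P @ s"
    using ij unfolding s_def by (metis append_take_drop_id less_imp_le min.absorb1 take_take)
  have height_s: "height s = 0"
    using assms(2) split by (simp add: next_same_hdist_def hdist_lattice_pt)
  have prefix: "height a \<noteq> 0" if "s = a @ b" "a \<noteq> []" "b \<noteq> []" for a b
  proof -
    have "length a + length b = j - i" using ij that(1) by (metis diff_le_self length_append length_drop length_take min.absorb2 s_def)
    moreover have "0 < length a" "0 < length b" using that by auto
    ultimately have len: "i < i + length a" "i + length a < j" using ij by linarith+
    have "take (i + length a) (take j P) = take i P @ a"
      using ij by (simp add: split that(1))
    then have "take (i + length a) P = take i P @ a" using len by (simp add: min_absorb1)
    then show ?thesis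
      using assms(2) len unfolding next_same_hdist_def hdist_lattice_pt
      by (metis add_cancel_left_right height_simps(5))
  qed
  have "s \<noteq> []" using ij by (simp add: s_def)
  then obtain x s' where s: "s = x # s'" by (cases s) auto
  have "s ! 0 = P ! i" using ij by (simp add: s_def)
  then have "P ! i = x" using s by simp
  then consider "x = Diag" | "x = North" using assms(1) by (auto simp: valley_at_def)
  then show ?thesis
  proof cases
    case 1
    then have "s' = []" using prefix[of "[Diag]" s'] s by auto
    then have "s = word [Flat]" using s 1 by simp
    then show ?thesis unfolding s_def by blast
  next
    case 2
    then have "height s' < 0" using height_s s by simp
    then obtain A v where v: "s' = word A @ East # v" using first_descent by blast
    then have "s = word [Arch A] @ v" using s 2 by simp
    then have "v = []" using prefix[of "word [Arch A]" v] by auto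
    then have "s = word [Arch A]" using s 2 v by simp
    then show ?thesis unfolding s_def by blast
  qed
qed

text \<open>Inside an arch the opening \<open>North\<close> adds 1 to a non-negative height, and a
  diagonal step has no proper non-empty prefix. So the next point at the height of a valley is the
  end of the factor, not earlier.\<close>

lemma word_single_prefix:
  assumes "word [p] = a @ b" "a \<noteq> []" "b \<noteq> []"
  shows "0 < height a"
proof (cases p)
  case Flat
  then have "length a + length b = 1" using arg_cong[OF assms(1), of length] by simp
  then show ?thesis using assms(2,3) by (cases a; cases b) simp_all
next
  case (Arch A)
  with assms obtain a' b' where a: "a = North # a'" "word A = a' @ b'"
    by (cases b rule: rev_cases) (auto simp: Cons_eq_append_conv)
  then have "0 \<le> height a'" using balanced_word[of A] by (auto simp: balanced_def)
  then show ?thesis using a by simp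
qed

lemma schroeder_cover_iff_rotation: "schroeder_cover P Q \<longleftrightarrow> schroeder_path P \<and> rotation P Q"
proof (intro iffI conjI)
  assume cover: "schroeder_cover P Q"
  then show "schroeder_path P" by (simp add: schroeder_cover_def)
  from cover obtain i j where ij: "valley_at P i" "next_same_hdist P i j"
    and Q: "Q = take (i - 1) P @ drop i (take j P) @ [East] @ drop j P"
    by (auto simp: schroeder_cover_def)
  obtain p where p: "drop i (take j P) = word [p]" using next_same_hdist_word ij by blast
  have "i < j" "j \<le> length P" using ij(2) by (auto simp: next_same_hdist_def)
  have "0 < i" "i < length P" "P ! (i - 1) = East" using ij(1) by (auto simp: valley_at_def)
  then have "take i P = take (i - 1) P @ [East]"
    by (metis One_nat_def Suc_pred less_imp_diff_less take_Suc_conv_app_nth)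
  moreover have "take j P = take i P @ drop i (take j P)"
    using \<open>i < j\<close> by (metis append_take_drop_id less_imp_le min.absorb1 take_take)
  ultimately have "P = take (i - 1) P @ East # word [p] @ drop j P"
    using p by (metis append.assoc append_Cons append_Nil append_take_drop_id)
  then show "rotation P Q"
    using Q p rotation.intros[of "take (i - 1) P" p "drop j P"] by simp
next
  assume "schroeder_path P \<and> rotation P Q"
  then obtain v p w where path: "schroeder_path P" and P: "P = v @ East # word [p] @ w"
    and Q: "Q = v @ word [p] @ East # w" by (auto elim: rotation.cases)
  \<comment> \<open>The \<open>East\<close> before the valley has index \<open>length v\<close>, so
    the valley is the point reached one step later.\<close>
  define i j where "i = Suc (length v)" and "j = i + length (word [p])"
  have "word [p] \<noteq> []" by simp
  have valley: "valley_at P i"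
    by (cases p) (auto simp: valley_at_def i_def P nth_append)
  have take_j: "take j P = v @ East # word [p]" by (simp add: P i_def j_def)
  have take_i: "take i P = v @ [East]" by (simp add: P i_def)
  have "height (take k P) \<noteq> height (take i P)" if k: "i < k" "k < j" for k
  proof -
    have "take k P = v @ East # take (k - i) (word [p])"
      using k by (simp add: P i_def j_def take_Cons' split: if_splits)
    moreover have "0 < height (take (k - i) (word [p]))"
      by (rule word_single_prefix[where b = "drop (k - i) (word [p])"])
         (use k in \<open>auto simp: j_def\<close>)
    ultimately show ?thesis using take_i by simp
  qed
  then have "next_same_hdist P i j"
    using take_i take_j \<open>word [p] \<noteq> []\<close>
    by (auto simp: next_same_hdist_def hdist_lattice_pt)
       (auto simp: P i_def j_def)
  moreover have "Q = take (i - 1) P @ drop i (take j P) @ [East] @ drop j P"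
    unfolding take_j by (simp add: P Q i_def j_def)
  ultimately show "schroeder_cover P Q"
    using path valley by (auto simp: schroeder_cover_def)
qed

text \<open>A valley rotation enlarges one arch by the primitive factor that follows it, so an arch of
  the larger path swallows an initial part \<open>B1\<close> of what follows the matching arch below.\<close>

inductive forest_le :: "primitive list \<Rightarrow> primitive list \<Rightarrow> bool" where
  Nil: "forest_le [] []"
| Flat: "forest_le A B \<Longrightarrow> forest_le (Flat # A) (Flat # B)"
| Arch: "forest_le (A @ B1) C \<Longrightarrow> forest_le B2 E \<Longrightarrow> forest_le (Arch A # B1 @ B2) (Arch C # E)"

inductive_cases forest_le_FlatE: "forest_le A (Flat # B)"
inductive_cases forest_le_ArchE: "forest_le A (Arch C # E)"

section \<open>The order on forests and its agreement with the order on paths\<close>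

lemma forest_le_refl: "forest_le A A"
proof (induction A rule: word.induct)
  case (3 A B)
  then show ?case using forest_le.Arch[of A "[]" A B B] by simp
qed (auto intro: forest_le.intros)

lemma forest_le_append: "forest_le A C \<Longrightarrow> forest_le B D \<Longrightarrow> forest_le (A @ B) (C @ D)"
proof (induction rule: forest_le.induct)
  case (Arch A B1 C B2 E)
  then show ?case using forest_le.Arch[of A B1 C "B2 @ B" "E @ D"] by simp
qed (auto intro: forest_le.intros)

text \<open>A cut of the upper forest pulls back to the lower one, since swallowed factors stay with
  their arch. A cut of the lower forest need not lift: an upper arch may swallow across it.\<close>

lemma forest_le_appendD:
  "forest_le A (C @ D) \<Longrightarrow> \<exists>A1 A2. A = A1 @ A2 \<and> forest_le A1 C \<and> forest_le A2 D"
proof (induction C arbitrary: A rule: word.induct)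
  case 1
  then show ?case by (auto intro: forest_le.Nil)
next
  case (2 C)
  then show ?case
    by (metis append_Cons forest_le.Flat forest_le_FlatE)
next
  case (3 C E)
  from "3.prems" obtain A1 B1 B2 where A: "A = Arch A1 # B1 @ B2" "forest_le (A1 @ B1) C"
    "forest_le B2 (E @ D)" by (auto elim: forest_le_ArchE)
  with "3.IH"(2) obtain B3 B4 where B: "B2 = B3 @ B4" "forest_le B3 E" "forest_le B4 D" by blast
  then have "forest_le (Arch A1 # B1 @ B3) (Arch C # E)" using A by (auto intro: forest_le.Arch)
  moreover have "A = (Arch A1 # B1 @ B3) @ B4" using A B by simp
  ultimately show ?case using B by blast
qed

text \<open>The middle arch swallows \<open>A2\<close> and the upper arch swallows
  \<open>B1\<close>. Cutting what lies below \<open>B1 @ B2\<close> gives the part \<open>A4\<close>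
  below \<open>B1\<close>, so the upper arch swallows \<open>A2 @ A4\<close> of the lowest
  forest.\<close>

lemma forest_le_trans: "forest_le B C \<Longrightarrow> forest_le A B \<Longrightarrow> forest_le A C"
proof (induction arbitrary: A rule: forest_le.induct)
  case Nil
  then show ?case .
next
  case (Flat B C)
  then show ?case by (metis forest_le.Flat forest_le_FlatE)
next
  case (Arch B B1 C B2 E)
  from \<open>forest_le A (Arch B # B1 @ B2)\<close> obtain A1 A2 A3 where
    A: "A = Arch A1 # A2 @ A3" "forest_le (A1 @ A2) B" "forest_le A3 (B1 @ B2)"
    by (auto elim: forest_le_ArchE)
  obtain A4 A5 where A3: "A3 = A4 @ A5" "forest_le A4 B1" "forest_le A5 B2"
    using forest_le_appendD[OF A(3)] by blast
  have "forest_le (A1 @ (A2 @ A4)) C" using Arch.IH(1) forest_le_append[OF A(2) A3(2)] by simp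
  moreover have "forest_le A5 E" using Arch.IH(2) A3 by blast
  ultimately show ?case using forest_le.Arch[of A1 "A2 @ A4" C A5 E] A A3 by simp
qed

text \<open>For a leading arch, the rotated \<open>East\<close> is its closing step, lies after it,
  or lies inside it. In the first case the arch swallows \<open>[p]\<close>; the others are settled
  by induction in the rest or in the inside.\<close>

lemma rotation_word:
  "word A = v @ East # word [p] @ w \<Longrightarrow> \<exists>B. v @ word [p] @ East # w = word B \<and> forest_le A B"
proof (induction A arbitrary: v w rule: word.induct)
  case 1
  then show ?case by simp
next
  case (2 A)
  then obtain v' where v: "v = Diag # v'" by (cases v) auto
  then obtain B where "v' @ word [p] @ East # w = word B" "forest_le A B"
    using 2 by auto
  then have "v @ word [p] @ East # w = word (Flat # B) \<and> forest_le (Flat # A) (Flat # B)"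
    using v by (simp add: forest_le.Flat)
  then show ?case by blast
next
  case (3 A B)
  then obtain v' where v: "v = North # v'" by (cases v) auto
  with "3.prems" have eq: "word A @ East # word B = v' @ East # word [p] @ w" by simp
  obtain us where "word A = v' @ us \<and> us @ East # word B = East # word [p] @ w \<or>
      word A @ us = v' \<and> East # word B = us @ East # word [p] @ w"
    using eq unfolding append_eq_append_conv2 by blast
  then consider
      "v' = word A" "word B = word [p] @ w"
    | v'' where "v' = word A @ East # v''" "word B = v'' @ East # word [p] @ w"
    | z where "word A = v' @ East # z" "z @ East # word B = word [p] @ w"
    by (cases us) auto
  then show ?case
  proof cases
    case 1
    then obtain C where C: "B = [p] @ C" "w = word C" using word_prefix by blast
    have "v @ word [p] @ East # w = word (Arch (A @ [p]) # C)" using v 1 C by (simp add: word_append)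
    moreover have "forest_le (Arch A # B) (Arch (A @ [p]) # C)"
      using forest_le.Arch[OF forest_le_refl forest_le_refl, of A "[p]" C] C by simp
    ultimately show ?thesis by blast
  next
    case (2 v'')
    then obtain C where C: "v'' @ word [p] @ East # w = word C" "forest_le B C"
      using "3.IH"(2) by blast
    then have "v @ word [p] @ East # w = word (Arch A # C)" using v 2 by simp
    moreover have "forest_le (Arch A # B) (Arch A # C)"
      using forest_le.Arch[OF _ C(2), of A "[]" A] by (simp add: forest_le_refl)
    ultimately show ?thesis by blast
  next
    case (3 z)
    \<comment> \<open>The rotated factor starts inside the arch, so it cannot extend beyond the closing step.\<close>
    have "0 \<le> height v' - 1"
    proof -
      have "word A = (v' @ [East]) @ z" using 3 by simp
      then have "0 \<le> height (v' @ [East])" using balanced_word[of A] unfolding balanced_def by blast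
      then show ?thesis by simp
    qed
    moreover have "height v' - 1 + height z = 0"
      using height_word[of A] unfolding 3(1) by simp
    ultimately have z_le: "height z \<le> 0" by simp
    obtain w' where w': "z = word [p] @ w'" "w = w' @ East # word B"
    proof -
      consider (a) w' where "z = word [p] @ w'" "w = w' @ East # word B"
        | (b) y where "(z @ [East]) @ y = word [p]"
        using 3(2) by (auto simp: append_eq_append_conv2 Cons_eq_append_conv)
      then show ?thesis
      proof cases
        case a
        then show ?thesis using that by blast
      next
        case b
        then have "0 \<le> height (z @ [East])" using balanced_word[of "[p]"] unfolding balanced_def by metis
        then show ?thesis using z_le by simp
      qed
    qed
    then obtain C where C: "v' @ word [p] @ East # w' = word C" "forest_le A C"
      using "3.IH"(1) 3 by blast
    then have "v @ word [p] @ East # w = word (Arch C # B)"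
      using v w' by (simp flip: C(1))
    moreover have "forest_le (Arch A # B) (Arch C # B)"
      using forest_le.Arch[of A "[]" C B B] C by (simp add: forest_le_refl)
    ultimately show ?thesis by blast
  qed
qed

lemma rotations_word: "rotation\<^sup>*\<^sup>* (word A) Q \<Longrightarrow> \<exists>B. Q = word B \<and> forest_le A B"
proof (induction rule: rtranclp_induct)
  case base
  then show ?case using forest_le_refl by blast
next
  case (step Q R)
  then obtain B where B: "Q = word B" "forest_le A B" by blast
  with step(2) obtain C where "R = word C" "forest_le B C"
    by (metis rotation.cases rotation_word)
  then show ?case using B forest_le_trans by blast
qed

lemma rotations_shift_East: "rotation\<^sup>*\<^sup>* (East # word B @ w) (word B @ East # w)"
proof (induction B)
  case (Cons p B)
  have "rotation (East # word (p # B) @ w) (word [p] @ East # word B @ w)"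
    using rotation.intros[of "[]" p "word B @ w"] word_Cons[of p B] by simp
  also have "rotation\<^sup>*\<^sup>* \<dots> (word [p] @ word B @ East # w)"
    using rotations_context[OF Cons, of "word [p]" "[]"] by simp
  finally (converse_rtranclp_into_rtranclp) show ?case
    using word_Cons[of p B] by simp
qed simp

text \<open>In the arch case the closing step first moves past \<open>B1\<close> one factor at a
  time, then the inside is raised to \<open>C\<close>, and finally the rest to
  \<open>E\<close>.\<close>

lemma forest_le_imp_rotations: "forest_le A B \<Longrightarrow> rotation\<^sup>*\<^sup>* (word A) (word B)"
proof (induction rule: forest_le.induct)
  case (Flat A B)
  then show ?case using rotations_context[of _ _ "[Diag]" "[]"] by simp
next
  case (Arch A B1 C B2 E)
  have "rotation\<^sup>*\<^sup>* (word (Arch A # B1 @ B2)) (North # word (A @ B1) @ East # word B2)"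
    using rotations_context[OF rotations_shift_East[of B1 "word B2"], of "North # word A" "[]"]
    by (simp add: word_append)
  moreover have "rotation\<^sup>*\<^sup>* \<dots> (North # word C @ East # word B2)"
    using rotations_context[OF Arch.IH(1), of "[North]" "East # word B2"] by simp
  moreover have "rotation\<^sup>*\<^sup>* \<dots> (word (Arch C # E))"
    using rotations_context[OF Arch.IH(2), of "North # word C @ [East]" "[]"] by simp
  ultimately show ?case by (meson rtranclp_trans)
qed simp

lemma schroeder_le_word_iff:
  assumes "A \<noteq> []"
  shows "word A \<le>\<^sub>S word B \<longleftrightarrow> forest_le A B"
proof
  assume le: "word A \<le>\<^sub>S word B"
  have "schroeder_cover \<le> rotation" by (simp add: le_fun_def schroeder_cover_iff_rotation)
  then have "schroeder_cover\<^sup>*\<^sup>* \<le> rotation\<^sup>*\<^sup>*" by (rule rtranclp_mono)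
  then have "rotation\<^sup>*\<^sup>* (word A) (word B)" using le unfolding schroeder_le_def by blast
  then show "forest_le A B" by (metis rotations_word word_inj)
next
  assume "forest_le A B"
  then have "rotation\<^sup>*\<^sup>* (word A) (word B)" by (rule forest_le_imp_rotations)
  then show "word A \<le>\<^sub>S word B" unfolding schroeder_le_def
  proof (induction rule: rtranclp_induct)
    case (step Q R)
    \<comment> \<open>A chain of rotations that starts at a non-empty word stays among non-empty
      words, so each of its links is a cover.\<close>
    then obtain C where C: "Q = word C" "forest_le A C" using rotations_word by blast
    have "C \<noteq> []" using C(2) assms by (auto elim: forest_le.cases)
    then have "schroeder_cover Q R"
      using step C by (auto simp: schroeder_cover_iff_rotation schroeder_path_iff_word)
    with step.IH show ?case by simp
  qed simp
qed

section \<open>The functional equation\<close>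

fun semilength :: "primitive list \<Rightarrow> nat" where
  "semilength [] = 0"
| "semilength (Flat # B) = Suc (semilength B)"
| "semilength (Arch A # B) = Suc (semilength A + semilength B)"

lemma semilength_append [simp]: "semilength (A @ B) = semilength A + semilength B"
  by (induction A rule: word.induct) simp_all

lemma semilength_eq_0_iff [simp]: "semilength A = 0 \<longleftrightarrow> A = []"
  by (cases A rule: word.cases) simp_all

lemma path_length_word: "path_length (word A) = 2 * semilength A"
  by (induction A rule: word.induct) (simp_all add: path_length_def)

text \<open>Every primitive factor has positive semilength, so a list can be cut at a given
  semilength in at most one place.\<close>

lemma semilength_append_inj:
  "A @ B = C @ D \<Longrightarrow> semilength A = semilength C \<Longrightarrow> A = C \<and> B = D"
  by (auto simp: append_eq_append_conv2)

lemma forest_le_semilength: "forest_le A B \<Longrightarrow> semilength A = semilength B"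
  by (induction rule: forest_le.induct) simp_all

section \<open>Decomposition of intervals by the first factor of the upper path\<close>

text \<open>At \<open>n = 0\<close> this contains the empty interval, which supplies the constant
  term 1 that separates \<open>interval_series_1\<close> from \<open>G\<close>.\<close>

definition forest_intervals :: "nat \<Rightarrow> (primitive list \<times> primitive list) set" where
  "forest_intervals n = {(A, B). forest_le A B \<and> semilength A = n}"

lemma finite_forest_intervals: "finite (forest_intervals n)"
proof -
  have "inj word" by (simp add: inj_def word_inj)
  have "finite {A. semilength A = n}"
  proof (rule finite_imageD)
    have "word ` {A. semilength A = n} \<subseteq> insert [] (schroeder_paths n)"
      by (auto simp: schroeder_paths_def schroeder_path_iff_word path_length_word)
    then show "finite (word ` {A. semilength A = n})"
      by (rule finite_subset) (simp add: finite_schroeder_paths)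
  qed (use \<open>inj word\<close> in \<open>auto intro: inj_on_subset\<close>)
  then have "finite ({A. semilength A = n} \<times> {A. semilength A = n})" by simp
  then show ?thesis
    by (rule rev_finite_subset) (auto simp: forest_intervals_def forest_le_semilength)
qed

lemma forest_intervals_0: "forest_intervals 0 = {([], [])}"
  by (auto simp: forest_intervals_def intro: forest_le.Nil elim: forest_le.cases)

definition add_flat :: "primitive list \<times> primitive list \<Rightarrow> primitive list \<times> primitive list" where
  "add_flat = map_prod ((#) Flat) ((#) Flat)"

text \<open>The number \<open>k\<close> says how many primitive factors of the lower path \<open>S\<close> stay inside the first
  arch.\<close>

fun add_arch ::
  "(primitive list \<times> primitive list) \<times> nat \<times> (primitive list \<times> primitive list) \<Rightarrow> primitive list \<times> primitive list" where
  "add_arch ((S, C), k, (B, E)) = (Arch (take k S) # drop k S @ B, Arch C # E)"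

text \<open>The bound on the cut position is inclusive: at \<open>length (fst I)\<close> the upper
  arch swallows nothing, at 0 the lower arch is empty.\<close>

definition arch_data ::
  "nat \<Rightarrow> nat \<Rightarrow> ((primitive list \<times> primitive list) \<times> nat \<times> (primitive list \<times> primitive list)) set" where
  "arch_data i j = (SIGMA I:forest_intervals i. {..length (fst I)} \<times> forest_intervals j)"

text \<open>The image shows \<open>C\<close>, \<open>E\<close>, \<open>take k S\<close> and
  \<open>drop k S @ B\<close>. Since \<open>S\<close> has the semilength of \<open>C\<close>, the
  semilength of \<open>drop k S\<close> is known, and this tells where \<open>B\<close>
  begins.\<close>

lemma inj_on_add_arch: "inj_on add_arch (\<Union>i\<le>n. arch_data i (n - i))"
proof (rule inj_onI)
  fix x y
  assume x: "x \<in> (\<Union>i\<le>n. arch_data i (n - i))" and y: "y \<in> (\<Union>i\<le>n. arch_data i (n - i))"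
    and eq: "add_arch x = add_arch y"
  obtain S C k B E where x': "x = ((S, C), k, (B, E))" by (metis prod.collapse)
  obtain S' C' k' B' E' where y': "y = ((S', C'), k', (B', E'))" by (metis prod.collapse)
  have le: "forest_le S C" "forest_le S' C'" "k \<le> length S" "k' \<le> length S'"
    using x y unfolding x' y' arch_data_def forest_intervals_def by auto
  have eqs: "take k S = take k' S'" "drop k S @ B = drop k' S' @ B'" "C = C'" "E = E'"
    using eq unfolding x' y' by auto
  have "semilength S = semilength S'" using le eqs forest_le_semilength by metis
  moreover have "semilength (take k S) + semilength (drop k S) = semilength S"
    "semilength (take k' S') + semilength (drop k' S') = semilength S'"
    by (metis append_take_drop_id semilength_append)+
  ultimately have "semilength (drop k S) = semilength (drop k' S')" using eqs(1) by simp
  then have drop: "drop k S = drop k' S'" "B = B'" using eqs(2) semilength_append_inj by blast+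
  have "k = k'" using arg_cong[OF eqs(1), of length] le by simp
  moreover have "S = S'" using eqs(1) drop by (metis append_take_drop_id)
  ultimately show "x = y" using eqs drop unfolding x' y' by simp
qed

lemma forest_intervals_Suc:
  "forest_intervals (Suc n) =
     add_flat ` forest_intervals n \<union> add_arch ` (\<Union>i\<le>n. arch_data i (n - i))"
proof (intro equalityI subsetI)
  fix I assume "I \<in> forest_intervals (Suc n)"
  then obtain A B where I: "I = (A, B)" "forest_le A B" "semilength A = Suc n"
    by (auto simp: forest_intervals_def)
  from I(2) show "I \<in> add_flat ` forest_intervals n \<union> add_arch ` (\<Union>i\<le>n. arch_data i (n - i))"
  proof cases
    case Nil
    with I show ?thesis by simp
  next
    case (Flat A' B')
    then have "I = add_flat (A', B')" "(A', B') \<in> forest_intervals n"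
      using I by (auto simp: add_flat_def forest_intervals_def)
    then show ?thesis by blast
  next
    case (Arch A' B1 C B2 E)
    define i where "i = semilength (A' @ B1)"
    have "I = add_arch ((A' @ B1, C), length A', (B2, E))" using I Arch by simp
    moreover have "((A' @ B1, C), length A', (B2, E)) \<in> arch_data i (n - i)" "i \<le> n"
      using I Arch by (auto simp: arch_data_def forest_intervals_def i_def)
    ultimately show ?thesis by blast
  qed
next
  fix I assume "I \<in> add_flat ` forest_intervals n \<union> add_arch ` (\<Union>i\<le>n. arch_data i (n - i))"
  then consider J where "J \<in> forest_intervals n" "I = add_flat J"
    | i J where "i \<le> n" "J \<in> arch_data i (n - i)" "I = add_arch J" by blast
  then show "I \<in> forest_intervals (Suc n)"
  proof cases
    case 1
    then show ?thesis by (auto simp: add_flat_def forest_intervals_def intro: forest_le.Flat)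
  next
    case (2 i J)
    obtain S C k B E where J: "J = ((S, C), k, (B, E))" by (metis prod.collapse)
    have *: "forest_le (take k S @ drop k S) C" "forest_le B E"
      "semilength S = i" "semilength B = n - i"
      using 2 unfolding J arch_data_def forest_intervals_def by auto
    have "semilength (take k S) + semilength (drop k S) = semilength S"
      by (metis append_take_drop_id semilength_append)
    then show ?thesis
      using forest_le.Arch[OF *(1,2)] * 2 by (simp add: forest_intervals_def J)
  qed
qed

text \<open>The outer variable marks the primitive factors, that is the returns to the diagonal, of the
  lower path.\<close>

definition interval_weight :: "primitive list \<times> primitive list \<Rightarrow> rat poly poly" where
  "interval_weight I = monom ([:0, 1:] ^ diag_steps (word (fst I))) (length (fst I))"

definition interval_poly :: "nat \<Rightarrow> rat poly poly" where
  "interval_poly n = (\<Sum>I\<in>forest_intervals n. interval_weight I)"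

lemma interval_weight_add_flat:
  "interval_weight (add_flat I) = [:0, [:0, 1:]:] * interval_weight I"
  by (simp add: interval_weight_def add_flat_def monom_Suc smult_monom)

text \<open>The first \<open>k\<close> factors of the lower path disappear into the arch. The arch
  itself, the other \<open>length (fst I) - k\<close> factors and those of \<open>J\<close> stay on
  the diagonal and keep their marks.\<close>

lemma interval_weight_add_arch:
  assumes "k \<le> length (fst I)"
  shows "interval_weight (add_arch (I, k, J)) =
    [:0, 1:] * monom ([:0, 1:] ^ diag_steps (word (fst I))) (length (fst I) - k) * interval_weight J"
proof -
  obtain S C B E where IJ: "I = (S, C)" "J = (B, E)" by (metis prod.collapse)
  have "word S = word (take k S) @ word (drop k S)" by (metis append_take_drop_id word_append)
  then have "diag_steps (word S) = diag_steps (word (take k S)) + diag_steps (word (drop k S))"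
    by simp
  then show ?thesis
    using assms
    by (simp add: IJ interval_weight_def word_append monom_Suc mult_monom power_add ac_simps)
qed

text \<open>The sum over all cut positions is geometric; multiplying by \<open>x - 1\<close>
  telescopes it and avoids a division.\<close>

lemma sum_monom_geometric:
  fixes c :: "'a :: comm_ring_1"
  shows "([:0, 1:] - 1) * (\<Sum>k\<le>n. monom c (n - k)) = [:0, 1:] * monom c n - [:c:]"
proof -
  have "(\<Sum>k\<le>n. monom c (n - k)) = (\<Sum>k\<le>n. monom c k)"
    by (rule sum.nat_diff_reindex[of _ "Suc n", simplified lessThan_Suc_atMost, simplified])
  also have "([:0, 1:] - 1) * \<dots> = [:0, 1:] * monom c n - [:c:]"
  proof (induction n)
    case 0
    then show ?case by (simp add: monom_0 one_pCons)
  next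
    case (Suc n)
    then show ?case by (simp add: distrib_left monom_Suc algebra_simps)
  qed
  finally show ?thesis .
qed

lemma interval_poly_0: "interval_poly 0 = 1"
  by (simp add: interval_poly_def forest_intervals_0 interval_weight_def monom_0 one_pCons)

text \<open>This is the coefficient form of the functional equation. The difference with the value
  at 1 comes from summing over the cut position of the first arch.\<close>

lemma interval_poly_Suc:
  "([:0, 1:] - 1) * interval_poly (Suc n) =
     [:0, [:0, 1:]:] * ([:0, 1:] - 1) * interval_poly n +
     [:0, 1:] * (\<Sum>i\<le>n. ([:0, 1:] * interval_poly i - [:poly (interval_poly i) 1:])
       * interval_poly (n - i))"
proof -
  let ?x = "[:0, 1:] :: rat poly poly"
  have finite_data: "finite (arch_data i j)" for i j
    by (auto simp: arch_data_def finite_forest_intervals)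
  have flat: "sum interval_weight (add_flat ` forest_intervals n) = [:0, [:0, 1:]:] * interval_poly n"
    by (subst sum.reindex)
       (auto simp: inj_on_def add_flat_def interval_poly_def sum_distrib_left
         interval_weight_add_flat[unfolded add_flat_def] intro!: sum.cong)
  have arch: "(?x - 1) * sum (interval_weight \<circ> add_arch) (arch_data i j) =
      ?x * ((?x * interval_poly i - [:poly (interval_poly i) 1:]) * interval_poly j)" for i j
  proof -
    have "sum (interval_weight \<circ> add_arch) (arch_data i j) =
      (\<Sum>I\<in>forest_intervals i. \<Sum>k\<le>length (fst I). \<Sum>J\<in>forest_intervals j.
         interval_weight (add_arch (I, k, J)))"
      unfolding arch_data_def
      by (simp add: sum.Sigma finite_forest_intervals sum.cartesian_product case_prod_unfold)
    also have "\<dots> = (\<Sum>I\<in>forest_intervals i. \<Sum>k\<le>length (fst I).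
        ?x * monom ([:0, 1:] ^ diag_steps (word (fst I))) (length (fst I) - k) * interval_poly j)"
      by (intro sum.cong refl)
         (simp add: interval_weight_add_arch interval_poly_def sum_distrib_left
           del: mult_pCons_left)
    also have "\<dots> = ?x * (\<Sum>I\<in>forest_intervals i. \<Sum>k\<le>length (fst I).
        monom ([:0, 1:] ^ diag_steps (word (fst I))) (length (fst I) - k)) * interval_poly j"
      by (simp only: sum_distrib_left sum_distrib_right)
    also have "(?x - 1) * \<dots> = ?x * (\<Sum>I\<in>forest_intervals i. (?x - 1) * (\<Sum>k\<le>length (fst I).
        monom ([:0, 1:] ^ diag_steps (word (fst I))) (length (fst I) - k))) * interval_poly j"
      by (simp only: sum_distrib_left[symmetric] mult_ac)
    \<comment> \<open>Setting \<open>x = 1\<close> erases the mark of a weight, so the constant left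
      by the geometric sum is the weight at 1.\<close>
    also have "\<dots> = ?x * (\<Sum>I\<in>forest_intervals i.
        ?x * interval_weight I - [:poly (interval_weight I) 1:]) * interval_poly j"
      by (simp only: sum_monom_geometric interval_weight_def poly_monom power_one mult_1_right)
    also have "\<dots> = ?x * (?x * interval_poly i - [:poly (interval_poly i) 1:]) * interval_poly j"
    proof -
      have "(\<Sum>I\<in>A. [:f I:]) = [:sum f A:]" for f :: "_ \<Rightarrow> rat poly" and A :: "(primitive list \<times> primitive list) set"
        by (induction A rule: infinite_finite_induct) simp_all
      then show ?thesis
        by (simp only: sum_subtractf sum_distrib_left[symmetric] interval_poly_def poly_sum)
    qed
    finally show ?thesis by (simp only: mult.assoc)
  qed
  have "interval_poly (Suc n) = sum interval_weight (add_flat ` forest_intervals n) +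
      sum interval_weight (add_arch ` (\<Union>i\<le>n. arch_data i (n - i)))"
    unfolding interval_poly_def forest_intervals_Suc
    by (rule sum.union_disjoint)
       (auto simp: finite_forest_intervals finite_data add_flat_def)
  also have "sum interval_weight (add_arch ` (\<Union>i\<le>n. arch_data i (n - i))) =
      sum (interval_weight \<circ> add_arch) (\<Union>i\<le>n. arch_data i (n - i))"
    by (rule sum.reindex[OF inj_on_add_arch])
  also have "\<dots> = (\<Sum>i\<le>n. sum (interval_weight \<circ> add_arch) (arch_data i (n - i)))"
    by (rule sum.UNION_disjoint)
       (simp, simp add: finite_data, auto simp: arch_data_def forest_intervals_def)
  finally have eq: "interval_poly (Suc n) = [:0, [:0, 1:]:] * interval_poly n +
      (\<Sum>i\<le>n. sum (interval_weight \<circ> add_arch) (arch_data i (n - i)))"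
    unfolding flat .
  have "(?x - 1) * (\<Sum>i\<le>n. sum (interval_weight \<circ> add_arch) (arch_data i (n - i))) =
      (\<Sum>i\<le>n. (?x - 1) * sum (interval_weight \<circ> add_arch) (arch_data i (n - i)))"
    by (rule sum_distrib_left)
  also have "\<dots> = (\<Sum>i\<le>n. ?x * ((?x * interval_poly i - [:poly (interval_poly i) 1:])
       * interval_poly (n - i)))"
    by (simp only: arch)
  also have "\<dots> = ?x * (\<Sum>i\<le>n. (?x * interval_poly i - [:poly (interval_poly i) 1:])
       * interval_poly (n - i))"
    by (rule sum_distrib_left[symmetric])
  finally show ?thesis unfolding eq distrib_left by (simp only: mult_ac)
qed

definition interval_series :: "rat poly poly fps" where
  "interval_series = Abs_fps interval_poly"

definition interval_series_1 :: "rat poly fps" where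
  "interval_series_1 = Abs_fps (\<lambda>n. poly (interval_poly n) 1)"

lemma G_eq_interval_series_1: "G = interval_series_1 - 1"
proof (rule fps_ext)
  fix n
  show "G $ n = (interval_series_1 - 1) $ n"
  proof (cases n)
    case 0
    then show ?thesis by (simp add: G_def interval_series_1_def interval_poly_0)
  next
    case (Suc m)
    have "bij_betw (map_prod word word) (forest_intervals n) (schroeder_intervals n)"
    proof (rule bij_betw_imageI)
      show "inj_on (map_prod word word) (forest_intervals n)"
        by (auto simp: inj_on_def word_inj)
      \<comment> \<open>Here \<open>n\<close> is positive, which excludes the empty forest, the only
        one whose word is not a Schroeder path.\<close>
      have path: "word A \<in> schroeder_paths n \<longleftrightarrow> semilength A = n" for A
        using Suc by (auto simp: schroeder_paths_def schroeder_path_iff_word path_length_word word_inj)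
      have "(word A, word B) \<in> schroeder_intervals n \<longleftrightarrow> (A, B) \<in> forest_intervals n" for A B
      proof (cases "semilength A = n")
        case True
        then have "A \<noteq> []" using Suc by auto
        then show ?thesis
          using True forest_le_semilength[of A B]
          by (auto simp: schroeder_intervals_def forest_intervals_def path schroeder_le_word_iff)
      qed (simp add: schroeder_intervals_def forest_intervals_def path)
      moreover have "\<exists>A B. P = word A \<and> Q = word B" if "(P, Q) \<in> schroeder_intervals n" for P Q
        using that by (auto simp: schroeder_intervals_def schroeder_paths_def schroeder_path_iff_word)
      ultimately show "map_prod word word ` forest_intervals n = schroeder_intervals n"
        by (intro equalityI subsetI) (auto, metis image_eqI map_prod_simp)
    qed
    from sum.reindex_bij_betw[OF this, symmetric, of "\<lambda>(P, Q). [:0, 1 :: rat:] ^ diag_steps P"]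
    have "(\<Sum>(P, Q)\<in>schroeder_intervals n. [:0, 1:] ^ diag_steps P) =
        (\<Sum>I\<in>forest_intervals n. [:0, 1 :: rat:] ^ diag_steps (word (fst I)))"
      by (simp add: case_prod_unfold)
    also have "\<dots> = poly (interval_poly n) 1"
      by (simp add: interval_poly_def interval_weight_def poly_sum poly_monom)
    finally show ?thesis using Suc by (simp add: G_def interval_series_1_def)
  qed
qed

text \<open>Over \<open>rat poly poly\<close> the mark \<open>x\<close> is
  \<open>fps_const [:0, 1:]\<close> and \<open>u\<close> is \<open>fps_const [:[:0, 1:]:]\<close>.
  The last series is F(1), embedded as a series free of \<open>x\<close>.\<close>

lemma interval_series_equation:
  "(fps_const [:0, 1:] - 1) * (interval_series - 1) =
     fps_X * fps_const [:0, 1:] * interval_series *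
       (fps_const [:[:0, 1:]:] * (fps_const [:0, 1:] - 1) + fps_const [:0, 1:] * interval_series
        - Abs_fps (\<lambda>n. [:interval_series_1 $ n:]))"
  (is "?L = ?R")
proof (rule fps_ext)
  fix n
  let ?x = "[:0, 1:] :: rat poly poly"
  have x: "fps_const ?x - 1 = fps_const (?x - 1)" by (simp flip: fps_const_sub)
  have R: "?R = fps_X * (fps_const ([:0, [:0, 1:]:] * (?x - 1)) * interval_series +
      fps_const ?x * ((fps_const ?x * interval_series - Abs_fps (\<lambda>n. [:interval_series_1 $ n:]))
        * interval_series))"
  proof -
    have "fps_const ([:0, [:0, 1:]:] * (?x - 1)) =
        fps_const ?x * fps_const [:[:0, 1:]:] * fps_const (?x - 1)"
      by (simp only: fps_const_mult) simp
    then show ?thesis unfolding x by (simp only: algebra_simps)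
  qed
  show "?L $ n = ?R $ n"
  proof (cases n)
    case 0
    then show ?thesis by (simp add: interval_series_def interval_poly_0)
  next
    case (Suc m)
    have "?L $ n = (?x - 1) * interval_poly (Suc m)"
      unfolding x using Suc by (simp add: interval_series_def del: fps_const_sub)
    also have "\<dots> = ?R $ n"
    proof -
      let ?A = "fps_const ?x * interval_series - Abs_fps (\<lambda>n. [:interval_series_1 $ n:])"
      have "?A $ i = ?x * interval_poly i - [:poly (interval_poly i) 1:]" for i
        by (simp add: interval_series_def interval_series_1_def del: mult_pCons_left)
      then have "(?A * interval_series) $ m =
          (\<Sum>i\<le>m. (?x * interval_poly i - [:poly (interval_poly i) 1:]) * interval_poly (m - i))"
        by (simp only: fps_mult_nth interval_series_def fps_nth_Abs_fps atLeast0AtMost)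
      moreover have "interval_series $ m = interval_poly m" by (simp add: interval_series_def)
      ultimately show ?thesis
        unfolding R interval_poly_Suc \<open>n = Suc m\<close>
        by (simp only: fps_mult_fps_X_plus_1_nth fps_add_nth fps_X_mult_nth nat.distinct if_False
              diff_Suc_1 fps_mult_left_const_nth)
    qed
    finally show ?thesis .
  qed
qed

section \<open>The kernel method\<close>

definition poly_at :: "'a :: comm_ring_1 fps \<Rightarrow> 'a poly \<Rightarrow> 'a fps" where
  "poly_at Y p = poly (map_poly fps_const p) Y"

lemma poly_at_0 [simp]: "poly_at Y 0 = 0"
  by (simp add: poly_at_def)

lemma poly_at_pCons [simp]: "poly_at Y (pCons a p) = fps_const a + Y * poly_at Y p"
  by (simp add: poly_at_def map_poly_pCons)

lemma poly_at_add: "poly_at Y (p + q) = poly_at Y p + poly_at Y q"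
  by (induction p q rule: poly_induct2) (simp_all add: algebra_simps flip: fps_const_add)

lemma poly_at_smult: "poly_at Y (smult c p) = fps_const c * poly_at Y p"
  by (induction p) (simp_all add: algebra_simps flip: fps_const_mult)

lemma poly_at_mult: "poly_at Y (p * q) = poly_at Y p * poly_at Y q"
  by (induction p) (simp_all add: poly_at_add poly_at_smult algebra_simps)

lemma poly_at_diff: "poly_at Y (p - q) = poly_at Y p - poly_at Y q"
  using poly_at_add[of Y "p - q" q] by simp

lemma poly_at_sum: "poly_at Y (\<Sum>i\<in>A. p i) = (\<Sum>i\<in>A. poly_at Y (p i))"
  by (induction A rule: infinite_finite_induct) (simp_all add: poly_at_add)

text \<open>The substitution \<open>x := Y\<close> in a series in \<open>t\<close> over the polynomials in \<open>x\<close>; it needs no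
  condition on the constant term of \<open>Y\<close>.\<close>

definition eval_at :: "'a :: comm_ring_1 fps \<Rightarrow> 'a poly fps \<Rightarrow> 'a fps" where
  "eval_at Y A = Abs_fps (\<lambda>n. \<Sum>k\<le>n. poly_at Y (A $ k) $ (n - k))"

text \<open>Up to a given order the substitution is a finite sum of powers of \<open>t\<close> times
  polynomials in \<open>Y\<close>, so products can be computed with finite sums.\<close>

lemma eval_at_nth_truncate:
  assumes "n \<le> N"
  shows "eval_at Y A $ n = (\<Sum>k\<le>N. fps_X ^ k * poly_at Y (A $ k)) $ n"
proof -
  have "(\<Sum>k\<le>N. fps_X ^ k * poly_at Y (A $ k)) $ n =
      (\<Sum>k\<le>N. if k \<le> n then poly_at Y (A $ k) $ (n - k) else 0)"
    by (auto simp: fps_sum_nth fps_X_power_mult_nth intro!: sum.cong)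
  also have "\<dots> = (\<Sum>k\<le>n. poly_at Y (A $ k) $ (n - k))"
    using assms by (intro sum.mono_neutral_cong_right) auto
  finally show ?thesis by (simp add: eval_at_def)
qed

lemma eval_at_mult: "eval_at Y (A * B) = eval_at Y A * eval_at Y B"
proof (rule fps_ext)
  fix n
  define a b where "a k = poly_at Y (A $ k)" and "b k = poly_at Y (B $ k)" for k
  have "(eval_at Y A * eval_at Y B) $ n =
      ((\<Sum>i\<le>n. fps_X ^ i * a i) * (\<Sum>j\<le>n. fps_X ^ j * b j)) $ n"
    by (simp add: fps_mult_nth a_def b_def eval_at_nth_truncate[of _ n])
  also have "\<dots> = (\<Sum>i\<le>n. \<Sum>j\<le>n. (fps_X ^ (i + j) * (a i * b j)) $ n)"
    by (simp add: sum_product fps_sum_nth power_add mult_ac)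
  also have "\<dots> = (\<Sum>(i, j)\<in>{..n} \<times> {..n}. (fps_X ^ (i + j) * (a i * b j)) $ n)"
    by (simp add: sum.cartesian_product)
  \<comment> \<open>Terms with \<open>i + j > n\<close> are divisible by a power of \<open>t\<close>
    too high to reach coefficient \<open>n\<close>.\<close>
  also have "\<dots> = (\<Sum>(i, j)\<in>{(i, j). i + j \<le> n}. (fps_X ^ (i + j) * (a i * b j)) $ n)"
    by (rule sum.mono_neutral_cong_right) (auto simp: fps_X_power_mult_nth split: if_splits)
  also have "\<dots> = (\<Sum>k\<le>n. \<Sum>i\<le>k. (fps_X ^ (i + (k - i)) * (a i * b (k - i))) $ n)"
    by (rule sum.triangle_reindex_eq)
  also have "\<dots> = (\<Sum>k\<le>n. (fps_X ^ k * poly_at Y ((A * B) $ k)) $ n)"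
    by (intro sum.cong refl)
       (simp add: fps_mult_nth[of A B] poly_at_sum poly_at_mult a_def b_def sum_distrib_left
         fps_sum_nth atLeast0AtMost)
  also have "\<dots> = eval_at Y (A * B) $ n"
    by (simp add: eval_at_nth_truncate[of n n] fps_sum_nth)
  finally show "eval_at Y (A * B) $ n = (eval_at Y A * eval_at Y B) $ n" by simp
qed

lemma eval_at_add: "eval_at Y (A + B) = eval_at Y A + eval_at Y B"
  by (rule fps_ext) (simp add: eval_at_def poly_at_add sum.distrib)

lemma eval_at_diff: "eval_at Y (A - B) = eval_at Y A - eval_at Y B"
  by (rule fps_ext) (simp add: eval_at_def poly_at_diff sum_subtractf)

lemma eval_at_const: "eval_at Y (fps_const p) = poly_at Y p"
proof (rule fps_ext)
  fix n
  show "eval_at Y (fps_const p) $ n = poly_at Y p $ n"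
    by (simp add: eval_at_def if_distrib[of "poly_at Y"] if_distrib[of "\<lambda>f. f $ _"]
          sum.delta' cong: if_cong)
qed

lemma eval_at_1: "eval_at Y 1 = 1"
proof -
  have "poly_at Y 1 = 1" by (simp add: one_pCons)
  then show ?thesis using eval_at_const[of Y 1] by simp
qed

lemma eval_at_coeffs: "eval_at Y (Abs_fps (\<lambda>n. [:c $ n:])) = c"
proof (rule fps_ext)
  fix n
  show "eval_at Y (Abs_fps (\<lambda>n. [:c $ n:])) $ n = c $ n"
    by (simp add: eval_at_def sum.delta' if_distrib cong: if_cong)
qed

lemma eval_at_X: "eval_at Y fps_X = fps_X"
proof -
  have "(fps_X :: 'a poly fps) = Abs_fps (\<lambda>n. [:fps_X $ n:])"
    by (rule fps_ext) (simp add: fps_X_def one_pCons)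
  then show ?thesis by (metis eval_at_coeffs)
qed

section \<open>Congruences modulo powers of \<open>t\<close> and fixed points\<close>

lemma fps_X_power_dvd_iff:
  fixes f :: "'a :: comm_ring_1 fps"
  shows "fps_X ^ N dvd f \<longleftrightarrow> (\<forall>n<N. f $ n = 0)"
proof
  assume "\<forall>n<N. f $ n = 0"
  then have "f = fps_X ^ N * fps_shift N f"
    by (intro fps_ext) (simp add: fps_X_power_mult_nth)
  then show "fps_X ^ N dvd f" by (rule dvdI)
qed (auto simp: fps_X_power_mult_nth elim!: dvdE)

lemma dvd_diff_mult:
  fixes d :: "'a :: comm_ring_1"
  assumes "d dvd a - b" "d dvd a' - b'"
  shows "d dvd a * a' - b * b'"
proof -
  have "a * a' - b * b' = a * (a' - b') + (a - b) * b'" by (simp add: algebra_simps)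
  then show ?thesis using assms by simp
qed

lemma dvd_diff_add:
  fixes d :: "'a :: comm_ring_1"
  assumes "d dvd a - b" "d dvd a' - b'"
  shows "d dvd (a + a') - (b + b')"
  using dvd_add[OF assms] by (simp add: algebra_simps)

lemma dvd_poly_at_diff: "Y - Z dvd poly_at Y p - poly_at Z p"
proof (induction p)
  case (pCons a p)
  then show ?case using dvd_diff_mult[of "Y - Z" Y Z "poly_at Y p" "poly_at Z p"] by simp
qed simp

lemma dvd_eval_at_diff:
  assumes "fps_X ^ N dvd Y - Z"
  shows "fps_X ^ N dvd eval_at Y A - eval_at Z A"
proof -
  have "fps_X ^ N dvd poly_at Y p - poly_at Z p" for p
    using assms dvd_poly_at_diff dvd_trans by blast
  then have "poly_at Y p $ n = poly_at Z p $ n" if "n < N" for p n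
    using that by (simp add: fps_X_power_dvd_iff)
  then show ?thesis
    by (auto simp: fps_X_power_dvd_iff eval_at_def intro!: sum.cong)
qed

text \<open>Banach's argument for the \<open>t\<close>-adic metric: each application fixes one more
  coefficient, so the iterates from 0 converge.\<close>

lemma fps_contraction_fixpoint:
  fixes \<Phi> :: "'a :: comm_ring_1 fps \<Rightarrow> 'a fps"
  assumes contraction: "\<And>N Y Z. fps_X ^ N dvd Y - Z \<Longrightarrow> fps_X ^ Suc N dvd \<Phi> Y - \<Phi> Z"
  shows "\<exists>Y. \<Phi> Y = Y"
proof -
  define Z where "Z k = (\<Phi> ^^ k) 0" for k
  \<comment> \<open>All iterates from \<open>Z (Suc n)\<close> on agree in coefficient
    \<open>n\<close>.\<close>
  define Y where "Y = Abs_fps (\<lambda>n. Z (Suc n) $ n)"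
  have step: "fps_X ^ k dvd Z (Suc k) - Z k" for k
  proof (induction k)
    case (Suc k)
    then show ?case using contraction by (simp add: Z_def)
  qed simp
  have cauchy: "fps_X ^ k dvd Z m - Z k" if "k \<le> m" for k m
    using that
  proof (induction m rule: dec_induct)
    case (step m)
    have "fps_X ^ k dvd Z (Suc m) - Z m"
      using \<open>fps_X ^ m dvd Z (Suc m) - Z m\<close> step(1) by (meson dvd_trans le_imp_power_dvd)
    with step.IH show ?case using dvd_add by fastforce
  qed simp
  have limit: "fps_X ^ k dvd Y - Z k" for k
  proof -
    have "(Y - Z k) $ n = 0" if "n < k" for n
    proof -
      have "fps_X ^ Suc n dvd Z k - Z (Suc n)" using cauchy[of "Suc n" k] that by simp
      then have "(Z k - Z (Suc n)) $ n = 0" unfolding fps_X_power_dvd_iff by blast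
      then show ?thesis by (simp add: Y_def)
    qed
    then show ?thesis by (simp add: fps_X_power_dvd_iff)
  qed
  have "\<Phi> Y $ n = Y $ n" for n
  proof -
    have "fps_X ^ Suc n dvd \<Phi> Y - Z (Suc n)" using contraction[OF limit] by (simp add: Z_def)
    then have "(\<Phi> Y - Z (Suc n)) $ n = 0" unfolding fps_X_power_dvd_iff by blast
    then show ?thesis by (simp add: Y_def)
  qed
  then show ?thesis by (blast intro: fps_ext)
qed

section \<open>Differentiation in \<open>x\<close> and the root of the kernel\<close>

definition coeff_pderiv :: "'a :: idom poly fps \<Rightarrow> 'a poly fps" where
  "coeff_pderiv A = Abs_fps (\<lambda>n. pderiv (A $ n))"

lemma coeff_pderiv_mult: "coeff_pderiv (A * B) = coeff_pderiv A * B + A * coeff_pderiv B"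
  by (rule fps_ext)
     (simp add: coeff_pderiv_def fps_mult_nth higher_pderiv_sum[of 1, simplified] pderiv_mult
        sum.distrib, simp add: mult.commute)

lemma coeff_pderiv_add: "coeff_pderiv (A + B) = coeff_pderiv A + coeff_pderiv B"
  by (rule fps_ext) (simp add: coeff_pderiv_def pderiv_add)

lemma coeff_pderiv_diff: "coeff_pderiv (A - B) = coeff_pderiv A - coeff_pderiv B"
  by (rule fps_ext) (simp add: coeff_pderiv_def pderiv_diff)

lemma coeff_pderiv_const: "coeff_pderiv (fps_const p) = fps_const (pderiv p)"
  by (rule fps_ext) (simp add: coeff_pderiv_def)

lemma coeff_pderiv_coeffs: "coeff_pderiv (Abs_fps (\<lambda>n. [:c $ n:])) = 0"
  by (rule fps_ext) (simp add: coeff_pderiv_def pderiv_pCons)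

lemma coeff_pderiv_X: "coeff_pderiv fps_X = 0"
  by (rule fps_ext) (simp add: coeff_pderiv_def fps_X_def)

text \<open>With \<open>A\<close> as F and \<open>g\<close> as F(1), this equation for
  \<open>Y\<close> says that the derivative of the functional equation with respect to F vanishes at
  \<open>x = Y\<close>. The factor \<open>fps_X\<close> makes the right-hand side a
  contraction.\<close>

lemma kernel_root_exists:
  fixes A :: "'a :: comm_ring_1 poly fps" and g u :: "'a fps"
  shows "\<exists>Y. Y = 1 + fps_X * (Y * (2 * (Y * eval_at Y A) + u * (Y - 1) - g))"
proof -
  let ?\<Psi> = "\<lambda>Y. Y * (2 * (Y * eval_at Y A) + u * (Y - 1) - g)"
  have "fps_X ^ Suc N dvd (1 + fps_X * ?\<Psi> Y) - (1 + fps_X * ?\<Psi> Z)"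
    if dvd: "fps_X ^ N dvd Y - Z" for N Y Z
  proof -
    have "fps_X ^ N dvd Y * eval_at Y A - Z * eval_at Z A"
      using dvd dvd_eval_at_diff by (blast intro: dvd_diff_mult)
    then have "fps_X ^ N dvd 2 * (Y * eval_at Y A) - 2 * (Z * eval_at Z A)"
      using dvd_diff_mult[of "fps_X ^ N" 2 2] by simp
    moreover have "fps_X ^ N dvd u * (Y - 1) - u * (Z - 1)"
      using dvd_diff_mult[of "fps_X ^ N" u u "Y - 1" "Z - 1"] dvd by simp
    ultimately have "fps_X ^ N dvd (2 * (Y * eval_at Y A) + u * (Y - 1)) -
        (2 * (Z * eval_at Z A) + u * (Z - 1))"
      by (rule dvd_diff_add)
    then have "fps_X ^ N dvd (2 * (Y * eval_at Y A) + u * (Y - 1) - g) -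
        (2 * (Z * eval_at Z A) + u * (Z - 1) - g)"
      by (simp only: diff_diff_eq2 diff_add_cancel)
    with dvd have "fps_X ^ N dvd ?\<Psi> Y - ?\<Psi> Z" by (rule dvd_diff_mult)
    then have "fps_X * fps_X ^ N dvd fps_X * (?\<Psi> Y - ?\<Psi> Z)" by (rule mult_dvd_mono[OF dvd_refl])
    then show ?thesis by (simp add: right_diff_distrib)
  qed
  from fps_contraction_fixpoint[of "\<lambda>Y. 1 + fps_X * ?\<Psi> Y", OF this] show ?thesis by metis
qed

text \<open>The root \<open>Y\<close> makes the derivative of the quadratic equation with respect to the unknown
  \<open>F\<close> vanish; the equation itself and its derivative with respect to \<open>x\<close> then give two
  further relations between \<open>Y\<close>, \<open>f = F(Y)\<close> and \<open>F(1)\<close>.\<close>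

lemma kernel_method:
  obtains Y f :: "rat poly fps" where
    "Y - 1 = var_t * Y^2 * f^2"
    "f * (1 - var_u * var_t * Y^2) = Y"
    "var_t * Y * interval_series_1 = var_t * Y * var_u * (Y - 1) + 2 * var_t * Y^2 * f - (Y - 1)"
proof -
  let ?x = "fps_const [:0, 1:] :: rat poly poly fps"
  let ?v = "fps_const [:[:0, 1:]:] :: rat poly poly fps"
  let ?c = "Abs_fps (\<lambda>n. [:interval_series_1 $ n:])"
  define F d where "F = interval_series" and "d = coeff_pderiv F"
  define g where "g = interval_series_1"
  obtain Y where Y: "Y = 1 + var_t * (Y * (2 * (Y * eval_at Y F) + var_u * (Y - 1) - g))"
    using kernel_root_exists by blast
  define f f' where "f = eval_at Y F" and "f' = eval_at Y d"
  have F: "(?x - 1) * (F - 1) = fps_X * ?x * F * (?v * (?x - 1) + ?x * F - ?c)"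
    using interval_series_equation by (simp only: F_def)
  have x': "coeff_pderiv ?x = 1" "coeff_pderiv ?v = 0" "coeff_pderiv (1 :: rat poly poly fps) = 0"
    using coeff_pderiv_const[of "1 :: rat poly poly"]
    by (simp_all add: coeff_pderiv_const pderiv_pCons)
  have dF: "(F - 1) + (?x - 1) * d = fps_X * (F * (?v * (?x - 1) + ?x * F - ?c) +
      ?x * d * (?v * (?x - 1) + ?x * F - ?c) + ?x * F * (?v + F + ?x * d))"
    using arg_cong[OF F, of coeff_pderiv]
    by (simp only: coeff_pderiv_mult coeff_pderiv_add coeff_pderiv_diff coeff_pderiv_X
          coeff_pderiv_coeffs x' d_def[symmetric]) (simp add: algebra_simps)
  have eval_x: "eval_at Y ?x = Y" "eval_at Y ?v = var_u"
    by (simp_all add: eval_at_const)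
  note eval_at = eval_at_mult eval_at_add eval_at_diff eval_at_1 eval_at_X eval_at_coeffs eval_x
    f_def[symmetric] f'_def[symmetric] g_def[symmetric]
  have K: "(Y - 1) * (f - 1) = var_t * Y * f * (var_u * (Y - 1) + Y * f - g)"
    using arg_cong[OF F, of "eval_at Y"] by (simp only: eval_at)
  have dK: "(f - 1) + (Y - 1) * f' = var_t * (f * (var_u * (Y - 1) + Y * f - g) +
      Y * f' * (var_u * (Y - 1) + Y * f - g) + Y * f * (var_u + f + Y * f'))"
    using arg_cong[OF dF, of "eval_at Y"] by (simp only: eval_at)
  have root: "Y = 1 + var_t * (Y * (2 * (Y * f) + var_u * (Y - 1) - g))"
    using Y by (simp only: f_def)
  show ?thesis
  proof
    \<comment> \<open>By \<open>root\<close>, \<open>t Y\<close> times the bracket of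
      \<open>K\<close> is \<open>Y - 1 - t Y^2 f\<close>; inserting this in \<open>K\<close> leaves
      the claim.\<close>
    show "Y - 1 = var_t * Y^2 * f^2" using K root by Groebner_Basis.algebra
    \<comment> \<open>By \<open>root\<close> the terms with \<open>f'\<close> cancel in
      \<open>dK\<close>. Multiplying the rest by \<open>Y\<close> and replacing the bracket as
      before gives the claim.\<close>
    show "f * (1 - var_u * var_t * Y^2) = Y" using K dK root by Groebner_Basis.algebra
    show "var_t * Y * interval_series_1 =
        var_t * Y * var_u * (Y - 1) + 2 * var_t * Y^2 * f - (Y - 1)"
      using root unfolding g_def[symmetric] by Groebner_Basis.algebra
  qed
qed

section \<open>The quintic and the closed form of \<open>G\<close>\<close>

text \<open>The difference of the two equations factors as \<open>(X - Y) * (1 + t * q)\<close>, and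
  the second factor has constant term 1.\<close>

lemma X_eq_unique:
  fixes t u X Y :: "rat poly fps"
  assumes t: "t = var_t"
    and X: "u^2 * t^2 * X^5 - t * (1 + u^2 * t) * X^4 - 2 * u * t * X^3 + 2 * u * t * X^2 + X - 1 = 0"
    and Y: "u^2 * t^2 * Y^5 - t * (1 + u^2 * t) * Y^4 - 2 * u * t * Y^3 + 2 * u * t * Y^2 + Y - 1 = 0"
  shows "X = Y"
proof -
  define q where "q = u^2 * t * (X^4 + X^3 * Y + X^2 * Y^2 + X * Y^3 + Y^4)
      - (1 + u^2 * t) * (X^3 + X^2 * Y + X * Y^2 + Y^3) - 2 * u * (X^2 + X * Y + Y^2)
      + 2 * u * (X + Y)"
  have "(X - Y) * (1 + t * q) = 0" using X Y unfolding q_def by Groebner_Basis.algebra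
  moreover have "(1 + t * q) $ 0 = 1" by (simp add: t)
  then have "1 + t * q \<noteq> 0" by (metis fps_zero_nth zero_neq_one)
  ultimately show ?thesis by simp
qed

lemma X_eq_solution:
  fixes t u :: "rat poly fps"
  assumes "t = var_t" and "u = var_u"
  obtains X where
    "u^2 * t^2 * X^5 - t * (1 + u^2 * t) * X^4 - 2 * u * t * X^3 + 2 * u * t * X^2 + X - 1 = 0"
    "G * (t * X * (u * t * X^2 - 1)) =
       u^2 * t^2 * X^4 - (u^2 * t^2 + u * t^2 + u * t + 2 * t) * X^3 + (1 + u * t + t) * X - 1"
    "t * X * (u * t * X^2 - 1) \<noteq> 0"
proof -
  define g where "g = interval_series_1"
  obtain X f where *: "X - 1 = t * X^2 * f^2" "f * (1 - u * t * X^2) = X"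
    "t * X * g = t * X * u * (X - 1) + 2 * t * X^2 * f - (X - 1)"
    using kernel_method unfolding assms g_def by blast
  show ?thesis
  proof
    \<comment> \<open>Multiplying the first relation by \<open>(1 - u * t * X^2)^2\<close> and using
      the square of the second gives \<open>(X - 1) * (1 - u * t * X^2)^2 = t * X^4\<close>, which
      is the quintic.\<close>
    show "u^2 * t^2 * X^5 - t * (1 + u^2 * t) * X^4 - 2 * u * t * X^3 + 2 * u * t * X^2 + X - 1 = 0"
      using *(1,2) by Groebner_Basis.algebra
    show "G * (t * X * (u * t * X^2 - 1)) =
        u^2 * t^2 * X^4 - (u^2 * t^2 + u * t^2 + u * t + 2 * t) * X^3 + (1 + u * t + t) * X - 1"
    proof -
      have "G * (t * X * (u * t * X^2 - 1)) = (t * X * g - t * X) * (u * t * X^2 - 1)"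
        by (simp add: G_eq_interval_series_1 g_def algebra_simps)
      also have "\<dots> = (t * X * u * (X - 1) - (X - 1) - t * X) * (u * t * X^2 - 1)
          - 2 * t * X^2 * (f * (1 - u * t * X^2))"
        unfolding *(3) by Groebner_Basis.algebra
      also have "\<dots> =
          u^2 * t^2 * X^4 - (u^2 * t^2 + u * t^2 + u * t + 2 * t) * X^3 + (1 + u * t + t) * X - 1"
        unfolding *(2) by Groebner_Basis.algebra
      finally show ?thesis .
    qed
    have "(X - 1) $ 0 = 0" unfolding *(1) by (simp add: assms)
    then have "X $ 0 = 1" by simp
    then have "X \<noteq> 0" by auto
    moreover have "(u * t * X^2 - 1) $ 0 = - 1" by (simp add: assms)
    then have "u * t * X^2 - 1 \<noteq> 0" by (metis fps_zero_nth neg_equal_0_iff_equal zero_neq_one)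
    ultimately show "t * X * (u * t * X^2 - 1) \<noteq> 0" by (simp add: assms)
  qed
qed

section \<open>Algebraicity\<close>

lemma rational_functionsI: "to_fract (fps_of_poly p) \<in> rational_functions"
  unfolding rational_functions_def
  by (rule CollectI, rule exI[of _ p], rule exI[of _ 1]) simp

lemma rational_functionsE:
  assumes "x \<in> rational_functions"
  obtains a b :: "rat poly poly" where "b \<noteq> 0"
    "x = to_fract (fps_of_poly a) / to_fract (fps_of_poly b)"
  using assms by (auto simp: rational_functions_def)

lemma to_fract_fps_of_poly_eq_0_iff [simp]: "to_fract (fps_of_poly p) = 0 \<longleftrightarrow> p = 0"
  using fps_of_poly_eq_iff[of p 0] by simp

lemma rational_functions_divide:
  "a \<in> rational_functions \<Longrightarrow> b \<in> rational_functions \<Longrightarrow> a / b \<in> rational_functions"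
proof (elim rational_functionsE)
  fix p q p' q' :: "rat poly poly"
  assume *: "q \<noteq> 0" "a = to_fract (fps_of_poly p) / to_fract (fps_of_poly q)"
    "q' \<noteq> 0" "b = to_fract (fps_of_poly p') / to_fract (fps_of_poly q')"
  show "a / b \<in> rational_functions"
  proof (cases "p' = 0")
    case True
    \<comment> \<open>Here \<open>b = 0\<close>, and the quotient is 0 by the convention for
      division.\<close>
    then show ?thesis using * rational_functionsI[of 0] by simp
  next
    case False
    then have "a / b = to_fract (fps_of_poly (p * q')) / to_fract (fps_of_poly (q * p'))" "q * p' \<noteq> 0"
      using * by (simp_all add: fps_of_poly_mult)
    then show ?thesis unfolding rational_functions_def by blast
  qed
qed

lemma rational_functions_diff:
  "a \<in> rational_functions \<Longrightarrow> b \<in> rational_functions \<Longrightarrow> a - b \<in> rational_functions"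
proof (elim rational_functionsE)
  fix p q p' q' :: "rat poly poly"
  assume *: "q \<noteq> 0" "a = to_fract (fps_of_poly p) / to_fract (fps_of_poly q)"
    "q' \<noteq> 0" "b = to_fract (fps_of_poly p') / to_fract (fps_of_poly q')"
  then have "a - b = to_fract (fps_of_poly (p * q' - p' * q)) / to_fract (fps_of_poly (q * q'))"
      "q * q' \<noteq> 0"
    by (simp_all add: fps_of_poly_mult fps_of_poly_diff diff_frac_eq mult.commute)
  then show "a - b \<in> rational_functions" unfolding rational_functions_def by blast
qed

definition is_subfield :: "'a :: field set \<Rightarrow> bool" where
  "is_subfield K \<longleftrightarrow> 1 \<in> K \<and> (\<forall>a\<in>K. \<forall>b\<in>K. a - b \<in> K \<and> a / b \<in> K)"

lemma is_subfield_closed: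
  assumes "is_subfield K"
  shows "0 \<in> K" "1 \<in> K"
    and "a \<in> K \<Longrightarrow> b \<in> K \<Longrightarrow> a - b \<in> K"
    and "a \<in> K \<Longrightarrow> b \<in> K \<Longrightarrow> a / b \<in> K"
    and "a \<in> K \<Longrightarrow> - a \<in> K"
    and "a \<in> K \<Longrightarrow> inverse a \<in> K"
    and "a \<in> K \<Longrightarrow> b \<in> K \<Longrightarrow> a + b \<in> K"
    and "a \<in> K \<Longrightarrow> b \<in> K \<Longrightarrow> a * b \<in> K"
    and "a \<in> K \<Longrightarrow> a ^ n \<in> K"
proof -
  show one: "1 \<in> K" and diff: "a \<in> K \<Longrightarrow> b \<in> K \<Longrightarrow> a - b \<in> K"
    and div: "a \<in> K \<Longrightarrow> b \<in> K \<Longrightarrow> a / b \<in> K" for a b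
    using assms by (auto simp: is_subfield_def)
  show zero: "0 \<in> K" using diff[OF one one] by simp
  show uminus: "- a \<in> K" if "a \<in> K" for a using diff[OF zero that] by simp
  show inverse: "inverse a \<in> K" if "a \<in> K" for a
    using div[OF one that] by (simp add: inverse_eq_divide)
  show "a + b \<in> K" if "a \<in> K" "b \<in> K" for a b using diff[OF that(1) uminus[OF that(2)]] by simp
  show mult: "a * b \<in> K" if "a \<in> K" "b \<in> K" for a b
    using div[OF that(1) inverse[OF that(2)]] by (simp add: divide_inverse)
  show "a ^ n \<in> K" if "a \<in> K" by (induction n) (simp_all add: one mult that)
qed

lemma is_subfield_rational_functions: "is_subfield rational_functions"
  using rational_functionsI[of 1]
  by (simp add: is_subfield_def rational_functions_divide rational_functions_diff)

section \<open>Algebraic elements form a subfield, transferred from rings with carriers\<close>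

lemma ring_of_type_algebra_simps:
  "carrier (ring_of_type_algebra :: 'a :: ring_1 ring) = UNIV"
  "monoid.mult (ring_of_type_algebra :: 'a :: ring_1 ring) = (*)"
  "one (ring_of_type_algebra :: 'a :: ring_1 ring) = 1"
  "ring.zero (ring_of_type_algebra :: 'a :: ring_1 ring) = 0"
  "add (ring_of_type_algebra :: 'a :: ring_1 ring) = (+)"
  by (simp_all add: ring_of_type_algebra_def)

context
  fixes R :: "'a :: field ring"
  defines "R \<equiv> ring_of_type_algebra"
begin

interpretation R: field R
  unfolding R_def by (rule field_from_type_algebra)

lemmas R_simps = ring_of_type_algebra_simps[where 'a = 'a, folded R_def]

lemma R_uminus: "a_inv R x = - x"
  by (rule R.minus_equality) (simp_all add: R_simps)

lemma R_inv: "x \<noteq> 0 \<Longrightarrow> m_inv R x = inverse x"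
  by (rule R.comm_inv_char) (simp_all add: R_simps)

lemma R_pow: "x [^]\<^bsub>R\<^esub> (n :: nat) = x ^ n"
  by (induction n) (simp_all add: R_simps mult.commute)

text \<open>Polynomials over a ring with a carrier are lists with the leading coefficient first,
  whereas \<open>Poly\<close> expects the constant one first; hence \<open>rev\<close>.\<close>

lemma R_eval: "R.eval p x = poly (Poly (rev p)) x"
  by (induction p) (simp_all add: R_simps R_pow Poly_append poly_monom)

lemma subfield_R_iff: "subfield K R \<longleftrightarrow> is_subfield K"
proof
  assume "is_subfield K"
  note closed = is_subfield_closed[OF this]
  show "subfield K R"
    by (rule R.subfieldI'[OF R.subringI]) (auto simp: R_simps R_uminus R_inv closed)
next
  assume "subfield K R"
  note K = subringE[OF subfieldE(1)[OF this]]
  have "a / b \<in> K" if "a \<in> K" "b \<in> K" for a b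
  proof (cases "b = 0")
    case True
    then show ?thesis using K(2) by (simp add: R_simps)
  next
    case False
    then have "inverse b \<in> K" using R.subfield_m_inv(1)[OF \<open>subfield K R\<close>, of b] that
      by (simp add: R_simps R_inv)
    then show ?thesis using K(6)[OF that(1)] by (simp add: R_simps divide_inverse)
  qed
  moreover have "a - b \<in> K" if "a \<in> K" "b \<in> K" for a b
    using K(7)[OF that(1) K(5)[OF that(2)]] by (simp add: R_simps R_uminus)
  ultimately show "is_subfield K" using K(3) by (simp add: is_subfield_def R_simps)
qed

lemma algebraic_R_iff:
  assumes "is_subfield K"
  shows "(R.algebraic over K) x \<longleftrightarrow> algebraic_over K x"
proof -
  have K: "subfield K R" using assms by (simp add: subfield_R_iff)
  have "0 \<in> K" using subringE(2)[OF subfieldE(1)[OF K]] by (simp add: R_simps)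
  show ?thesis
  proof
    assume "(R.algebraic over K) x"
    then obtain p where p: "p \<in> carrier (univ_poly R K)" "p \<noteq> []" "R.eval p x = 0"
      using R.algebraicE[OF subfieldE(1)[OF K]] by (metis R_simps(1,4) UNIV_I)
    then have set: "set p \<subseteq> K" and hd: "hd p \<noteq> 0"
      by (auto simp: univ_poly_def polynomial_def R_simps)
    \<comment> \<open>A non-empty list in \<open>univ_poly R K\<close> has a non-zero head, its
      leading coefficient, which makes the polynomial non-zero.\<close>
    have "coeff (Poly (rev p)) (length p - 1) = hd p"
      using p(2) by (simp add: nth_default_def rev_nth hd_conv_nth)
    then have "Poly (rev p) \<noteq> 0" using hd by (metis coeff_0)
    moreover have "coeff (Poly (rev p)) i \<in> K" for i
      using set \<open>0 \<in> K\<close> by (auto simp: nth_default_def) (metis length_rev nth_mem set_rev subsetD)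
    ultimately show "algebraic_over K x"
      using p(3) unfolding algebraic_over_def R_eval by blast
  next
    assume "algebraic_over K x"
    then obtain p where p: "p \<noteq> 0" "\<And>i. coeff p i \<in> K" "poly p x = 0"
      by (auto simp: algebraic_over_def)
    have "rev (coeffs p) \<noteq> []" "hd (rev (coeffs p)) \<noteq> 0"
      using p(1) by (auto simp: hd_rev last_coeffs_eq_coeff_degree)
    moreover have "set (coeffs p) \<subseteq> K" using p(2) by (auto simp: coeffs_def)
    ultimately have "rev (coeffs p) \<in> carrier (univ_poly R K)"
      by (auto simp: univ_poly_def polynomial_def R_simps)
    then show "(R.algebraic over K) x"
      by (rule R.algebraicI) (use p in \<open>simp_all add: R_eval R_simps\<close>)
  qed
qed

text \<open>This lets algebraicity of \<open>G\<close> be read off its expression in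
  \<open>t\<close>, \<open>u\<close> and \<open>X\<close>.\<close>

lemma is_subfield_algebraic_over:
  fixes K :: "'a set"
  assumes "is_subfield K"
  shows "is_subfield {x. algebraic_over K x}"
proof -
  have "subfield {x \<in> carrier R. (R.algebraic over K) x} R"
    using assms by (intro R.subfield_of_algebraics) (simp add: subfield_R_iff)
  then show ?thesis using assms by (simp add: subfield_R_iff algebraic_R_iff R_simps(1))
qed

end

lemma algebraic_over_rational_functions:
  fixes t u X :: "rat poly fps"
  assumes t: "t = var_t" and u: "u = var_u"
    and X: "u^2 * t^2 * X^5 - t * (1 + u^2 * t) * X^4 - 2 * u * t * X^3 + 2 * u * t * X^2 + X - 1 = 0"
    and g: "g = to_fract (u^2 * t^2 * X^4 - (u^2 * t^2 + u * t^2 + u * t + 2 * t) * X^3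
                 + (1 + u * t + t) * X - 1) / to_fract (t * X * (u * t * X^2 - 1))"
  shows "algebraic_over rational_functions g"
proof -
  define t' u' X' where "t' = to_fract t" and "u' = to_fract u" and "X' = to_fract X"
  have power: "to_fract (x ^ n) = to_fract x ^ n" for x :: "rat poly fps" and n
    by (induction n) simp_all
  \<comment> \<open>The closure rules for subfields know 1 and sums but no numerals, so 2 is written
    as a sum from here on.\<close>
  have two: "to_fract (2 :: rat poly fps) = 1 + 1"
    by (metis one_add_one to_fract_1 to_fract_add)
  note to_fract = to_fract_add to_fract_diff to_fract_mult to_fract_1 to_fract_0 power two
    t'_def[symmetric] u'_def[symmetric] X'_def[symmetric]
  note K = is_subfield_closed[OF is_subfield_rational_functions]
  have tu_mem: "t' \<in> rational_functions" "u' \<in> rational_functions"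
    using rational_functionsI[of "[:0, 1:]"] rational_functionsI[of "[:[:0, 1:]:]"]
    by (simp_all add: t'_def u'_def t u fps_of_poly_const)
  \<comment> \<open>The quintic as a polynomial in \<open>X'\<close>, constant coefficient first;
    that coefficient is -1, so \<open>p\<close> is non-zero.\<close>
  define p where "p = [:- 1, 1, (1 + 1) * u' * t', - ((1 + 1) * u' * t'), - (t' * (1 + u'^2 * t')),
    u'^2 * t'^2:]"
  have root: "u'^2 * t'^2 * X'^5 - t' * (1 + u'^2 * t') * X'^4 - (1 + 1) * u' * t' * X'^3
      + (1 + 1) * u' * t' * X'^2 + X' - 1 = 0"
    using arg_cong[OF X, of to_fract] by (simp only: to_fract)
  have coeff_pCons_mem: "(\<forall>i. coeff (pCons a q) i \<in> rational_functions) \<longleftrightarrow>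
      a \<in> rational_functions \<and> (\<forall>i. coeff q i \<in> rational_functions)" for a q
    by (auto simp: coeff_pCons split: nat.split)
  have "poly p X' = u'^2 * t'^2 * X'^5 - t' * (1 + u'^2 * t') * X'^4 - (1 + 1) * u' * t' * X'^3
      + (1 + 1) * u' * t' * X'^2 + X' - 1"
    unfolding p_def poly_pCons poly_0
    by (simp add: algebra_simps eval_nat_numeral del: one_add_one)
  then have "poly p X' = 0" using root by (rule trans)
  moreover have "\<forall>i. coeff p i \<in> rational_functions"
    unfolding p_def coeff_pCons_mem coeff_0 by (intro conjI allI K tu_mem)
  moreover have "p \<noteq> 0" by (simp add: p_def)
  ultimately have X': "algebraic_over rational_functions X'"
    unfolding algebraic_over_def by blast
  have base: "algebraic_over rational_functions a" if "a \<in> rational_functions" for a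
    unfolding algebraic_over_def
    by (rule exI[of _ "[:- a, 1:]"]) (auto simp: coeff_pCons K that split: nat.split)
  note A = is_subfield_closed[OF is_subfield_algebraic_over[OF is_subfield_rational_functions],
      unfolded mem_Collect_eq]
  show ?thesis
    unfolding g to_fract by (intro A X' base tu_mem)
qed

theorem theorem5p2:
  fixes t u :: "rat poly fps" and X_eq :: "rat poly fps \<Rightarrow> bool"
  defines "t \<equiv> var_t" and "u \<equiv> var_u"
  defines "X_eq \<equiv> \<lambda>X. u^2 * t^2 * X^5 - t * (1 + u^2 * t) * X^4
                        - 2 * u * t * X^3 + 2 * u * t * X^2 + X - 1 = 0"
  shows "algebraic_over rational_functions (to_fract G) \<and>
         (\<exists>!X. X_eq X) \<and>
         (\<forall>X. X_eq X \<longrightarrow>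
            t * X * (u * t * X^2 - 1) \<noteq> 0 \<and>
            to_fract G =
              to_fract (u^2 * t^2 * X^4 - (u^2 * t^2 + u * t^2 + u * t + 2 * t) * X^3
                         + (1 + u * t + t) * X - 1)
              / to_fract (t * X * (u * t * X^2 - 1)))"
proof -
  have tu: "t = var_t" "u = var_u" by (simp_all add: t_def u_def)
  obtain X where X: "X_eq X"
    and G: "G * (t * X * (u * t * X^2 - 1)) =
      u^2 * t^2 * X^4 - (u^2 * t^2 + u * t^2 + u * t + 2 * t) * X^3 + (1 + u * t + t) * X - 1"
    and nz: "t * X * (u * t * X^2 - 1) \<noteq> 0"
    using X_eq_solution[OF tu] unfolding X_eq_def by metis
  have unique: "Y = X" if "X_eq Y" for Y
    using X_eq_unique[OF tu(1)] that X unfolding X_eq_def by blast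
  have "to_fract G * to_fract (t * X * (u * t * X^2 - 1)) =
      to_fract (u^2 * t^2 * X^4 - (u^2 * t^2 + u * t^2 + u * t + 2 * t) * X^3
        + (1 + u * t + t) * X - 1)"
    unfolding G[symmetric] by (rule to_fract_mult[symmetric])
  then have formula: "to_fract G =
      to_fract (u^2 * t^2 * X^4 - (u^2 * t^2 + u * t^2 + u * t + 2 * t) * X^3
        + (1 + u * t + t) * X - 1) / to_fract (t * X * (u * t * X^2 - 1))"
    using nz by (simp only: eq_divide_eq to_fract_eq_0_iff simp_thms if_True)
  have "algebraic_over rational_functions (to_fract G)"
    using algebraic_over_rational_functions[OF tu _ formula] X unfolding X_eq_def by blast
  moreover have "\<exists>!Y. X_eq Y" using X unique by blast
  moreover have "t * Y * (u * t * Y^2 - 1) \<noteq> 0 \<and> to_fract G =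
      to_fract (u^2 * t^2 * Y^4 - (u^2 * t^2 + u * t^2 + u * t + 2 * t) * Y^3
        + (1 + u * t + t) * Y - 1) / to_fract (t * Y * (u * t * Y^2 - 1))" if "X_eq Y" for Y
    unfolding unique[OF that] using nz formula by (rule conjI)
  ultimately show ?thesis by blast
qed

end
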